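(* Let $V$ be an $\mathrm{FI}_{BC}\sharp$-module over a field $k$ of characteristic zero. If $V$ is finitely generated in degree $\le d$, then the characters of the $B_n$-representations $V_n$ are equal to a unique character polynomial $F_V\in k[X_1,Y_1,X_2,Y_2,\dots]$ of degree at most $d$, with equality for every value of $n\ge0$. The dimensions of $V_n$ are given by a polynomial of degree at most $d$: $$\dim_k(V_n)=F_V(n,0,0,\dots)\qquad\text{for every value of } n.$$
   Context: $B_n$ is the group of signed permutations of $\mathbf n=\{\pm1,\dots,\pm n\}$ (bijections $w$ with $w(-a)=-w(a)$). $\mathrm{FI}_{BC}$ has objects $\mathbf n$, $n\ge0$ ($\mathbf 0=\varnothing$), and morphisms the injections $f:\mathbf m\to\mathbf n$ with $f(-a)=-f(a)$. $\mathrm{FI}_{BC}\sharp$ has objects $\mathbf n_0=\{0,\pm1,\dots,\pm n\}$ and morphisms the maps $f:\mathbf m_0\to\mathbf n_0$ with $f(-a)=-f(a)$ for all $a$ and $|f^{-1}(b)|\le1$ for $1\le|b|\le n$. An $\mathrm{FI}_{BC}\sharp$-module over $k$ is a functor $\mathrm{FI}_{BC}\sharp\to k$-Mod, with $V_n:=V(\mathbf n_0)$; restricting to injective morphisms gives an $\mathrm{FI}_{BC}$-module (functor $\mathrm{FI}_{BC}\to k$-Mod), and $V$ is finitely generated in degree $\le d$ if a finite subset of $\coprod_{n\le d}V_n$ is contained in no proper sub-$\mathrm{FI}_{BC}$-module. Each element of $B_n$ is a product of signed cycles; an $r$-cycle is positive (negative) if it reverses an even (odd) number of signs. $X_r$,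 $Y_r$ count positive, negative $r$-cycles. A character polynomial is an element of $k[X_1,Y_1,X_2,Y_2,\dots]$, viewed as a function on $\coprod_nB_n$, with $\deg X_r=\deg Y_r=r$. $F_V(n,0,0,\dots)$ means setting $X_1=n$ and all other variables to $0$. *)

theory Defs
  imports
    Complex_Main
    "HOL-Library.FuncSet"
    "HOL-Library.Poly_Mapping"
    "HOL-Combinatorics.Orbits"
    "HOL-Computational_Algebra.Polynomial"
begin

definition signed :: "nat \<Rightarrow> int set" where
  "signed n = {- int n..int n} - {0}"

definition signed0 :: "nat \<Rightarrow> int set" where
  "signed0 n = {- int n..int n}"

text \<open>Morphisms are extensional functions, so that equality of morphisms is equality in HOL.\<close>

definition FIBC :: "nat \<Rightarrow> nat \<Rightarrow> (int \<Rightarrow> int) set" where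
  "FIBC m n = {f \<in> signed m \<rightarrow>\<^sub>E signed n.
     inj_on f (signed m) \<and> (\<forall>a\<in>signed m. f (- a) = - f a)}"

definition FIBC_sharp :: "nat \<Rightarrow> nat \<Rightarrow> (int \<Rightarrow> int) set" where
  "FIBC_sharp m n = {f \<in> signed0 m \<rightarrow>\<^sub>E signed0 n.
     (\<forall>a\<in>signed0 m. f (- a) = - f a) \<and>
     (\<forall>b. 1 \<le> \<bar>b\<bar> \<and> \<bar>b\<bar> \<le> int n \<longrightarrow> card {a \<in> signed0 m. f a = b} \<le> 1)}"

definition signed_perms :: "nat \<Rightarrow> (int \<Rightarrow> int) set" where
  "signed_perms n = {w \<in> extensional (signed n).
     bij_betw w (signed n) (signed n) \<and> (\<forall>a\<in>signed n. w (- a) = - w a)}"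

text \<open>The functor identifying \<open>FIBC\<close> with the injective morphisms of \<open>FIBC_sharp\<close>.\<close>

definition extend0 :: "nat \<Rightarrow> (int \<Rightarrow> int) \<Rightarrow> int \<Rightarrow> int" where
  "extend0 m f = (\<lambda>a\<in>signed0 m. if a = 0 then 0 else f a)"

text \<open>
  The spaces \<open>V n\<close> are subspaces of one ambient vector space; this is no restriction, since any
  sequence of vector spaces embeds in its direct sum. The source category has the naturals as
  objects and functions \<open>Obj m \<rightarrow> Obj n\<close> as morphisms, and \<open>act m n f\<close> is the linear map
  \<open>V m \<rightarrow> V n\<close> induced by \<open>f\<close>; its values outside \<open>V m\<close> are irrelevant.
\<close>

locale kmod_functor = vector_space scale
  for scale :: "'k::field \<Rightarrow> 'v::ab_group_add \<Rightarrow> 'v" +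
  fixes Obj :: "nat \<Rightarrow> int set"
    and Hom :: "nat \<Rightarrow> nat \<Rightarrow> (int \<Rightarrow> int) set"
    and V :: "nat \<Rightarrow> 'v set"
    and act :: "nat \<Rightarrow> nat \<Rightarrow> (int \<Rightarrow> int) \<Rightarrow> 'v \<Rightarrow> 'v"
  assumes subspace_V: "subspace (V n)"
    and act_in: "f \<in> Hom m n \<Longrightarrow> v \<in> V m \<Longrightarrow> act m n f v \<in> V n"
    and act_add: "f \<in> Hom m n \<Longrightarrow> u \<in> V m \<Longrightarrow> v \<in> V m \<Longrightarrow>
      act m n f (u + v) = act m n f u + act m n f v"
    and act_scale: "f \<in> Hom m n \<Longrightarrow> v \<in> V m \<Longrightarrow> act m n f (scale c v) = scale c (act m n f v)"
    and act_id: "v \<in> V n \<Longrightarrow> act n n (restrict id (Obj n)) v = v"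
    and act_comp: "f \<in> Hom l m \<Longrightarrow> g \<in> Hom m n \<Longrightarrow> v \<in> V l \<Longrightarrow>
      act l n (compose (Obj l) g f) v = act m n g (act l m f v)"
begin

definition submodule :: "(nat \<Rightarrow> 'v set) \<Rightarrow> bool" where
  "submodule W \<longleftrightarrow> (\<forall>n. subspace (W n) \<and> W n \<subseteq> V n) \<and>
     (\<forall>m n. \<forall>f\<in>Hom m n. \<forall>v\<in>W m. act m n f v \<in> W n)"

definition finitely_generated_le :: "nat \<Rightarrow> bool" where
  "finitely_generated_le d \<longleftrightarrow> (\<exists>S. finite S \<and> S \<subseteq> (SIGMA n:{..d}. V n) \<and>
     (\<forall>W. submodule W \<and> S \<subseteq> (SIGMA n:UNIV. W n) \<longrightarrow> W = V))"

end

abbreviation FIBC_module ::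
  "('k::field \<Rightarrow> 'v::ab_group_add \<Rightarrow> 'v) \<Rightarrow> (nat \<Rightarrow> 'v set) \<Rightarrow>
   (nat \<Rightarrow> nat \<Rightarrow> (int \<Rightarrow> int) \<Rightarrow> 'v \<Rightarrow> 'v) \<Rightarrow> bool" where
  "FIBC_module scale V act \<equiv> kmod_functor scale signed FIBC V act"

abbreviation FIBC_sharp_module ::
  "('k::field \<Rightarrow> 'v::ab_group_add \<Rightarrow> 'v) \<Rightarrow> (nat \<Rightarrow> 'v set) \<Rightarrow>
   (nat \<Rightarrow> nat \<Rightarrow> (int \<Rightarrow> int) \<Rightarrow> 'v \<Rightarrow> 'v) \<Rightarrow> bool" where
  "FIBC_sharp_module scale V act \<equiv> kmod_functor scale signed0 FIBC_sharp V act"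

definition restrict_FIBC ::
  "(nat \<Rightarrow> nat \<Rightarrow> (int \<Rightarrow> int) \<Rightarrow> 'v \<Rightarrow> 'v) \<Rightarrow> nat \<Rightarrow> nat \<Rightarrow> (int \<Rightarrow> int) \<Rightarrow> 'v \<Rightarrow> 'v" where
  "restrict_FIBC act m n f = act m n (extend0 m f)"

lemma extend0_in_FIBC_sharp:
  assumes "f \<in> FIBC m n"
  shows "extend0 m f \<in> FIBC_sharp m n"
proof -
  have f: "f a \<in> signed n" "f (- a) = - f a" if "a \<in> signed m" for a
    using assms that by (auto simp: FIBC_def)
  have inj: "inj_on f (signed m)"
    using assms by (simp add: FIBC_def)
  have "card {a \<in> signed0 m. extend0 m f a = b} \<le> 1" if "1 \<le> \<bar>b\<bar>" for b
  proof -
    have fin: "finite {a \<in> signed0 m. extend0 m f a = b}"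
      by (rule finite_subset[of _ "signed0 m"]) (auto simp: signed0_def)
    have "x = y" if "x \<in> signed0 m" "extend0 m f x = b" "y \<in> signed0 m" "extend0 m f y = b" for x y
    proof -
      have "x \<noteq> 0" "y \<noteq> 0"
        using that \<open>1 \<le> \<bar>b\<bar>\<close> by (auto simp: extend0_def)
      with that have "x \<in> signed m" "y \<in> signed m" "f x = f y"
        by (auto simp: extend0_def signed_def signed0_def)
      then show ?thesis
        using inj by (auto dest: inj_onD)
    qed
    then show ?thesis
      using card_le_Suc0_iff_eq[OF fin] by simp
  qed
  moreover have "extend0 m f a \<in> signed0 n \<and> extend0 m f (- a) = - extend0 m f a"
    if "a \<in> signed0 m" for a
  proof (cases "a = 0")
    case False
    with that have a: "a \<in> signed m" "- a \<in> signed0 m"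
      by (simp_all add: signed_def signed0_def)
    show ?thesis
      using f[OF a(1)] a that False by (simp add: extend0_def signed_def signed0_def)
  qed (simp add: extend0_def signed0_def)
  moreover have "extend0 m f \<in> extensional (signed0 m)"
    by (simp add: extend0_def)
  ultimately show ?thesis
    by (simp add: FIBC_sharp_def PiE_def)
qed

lemma extend0_compose:
  assumes "f \<in> FIBC l m"
  shows "extend0 l (compose (signed l) g f) = compose (signed0 l) (extend0 m g) (extend0 l f)"
proof
  fix a
  have "f a \<in> signed m" if "a \<in> signed l"
    using assms that by (auto simp: FIBC_def)
  then show "extend0 l (compose (signed l) g f) a
      = compose (signed0 l) (extend0 m g) (extend0 l f) a"
    by (auto simp: extend0_def compose_def signed_def signed0_def)
qed

lemma extend0_id: "extend0 n (restrict id (signed n)) = restrict id (signed0 n)"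
  by (auto simp: extend0_def signed_def signed0_def)

lemma FIBC_module_restrict:
  assumes "FIBC_sharp_module scale V act"
  shows "FIBC_module scale V (restrict_FIBC act)"
proof -
  interpret kmod_functor scale signed0 FIBC_sharp V act by (rule assms)
  show ?thesis
    by unfold_locales
      (simp_all add: restrict_FIBC_def subspace_V act_in act_add act_scale act_id act_comp
        extend0_id extend0_compose extend0_in_FIBC_sharp)
qed

definition (in vector_space) finite_dim_on :: "'b set \<Rightarrow> bool" where
  "finite_dim_on W \<longleftrightarrow> (\<exists>B. finite B \<and> span B = W)"

text \<open>The trace of an endomorphism of a finite-dimensional subspace \<open>W\<close>, as the sum of the
  diagonal matrix entries with respect to some basis.\<close>

definition (in vector_space) trace_on :: "'b set \<Rightarrow> ('b \<Rightarrow> 'b) \<Rightarrow> 'a" where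
  "trace_on W T = (let B = (SOME B. independent B \<and> span B = W)
     in \<Sum>b\<in>B. representation B (T b) b)"

definition character ::
  "('k::field \<Rightarrow> 'v::ab_group_add \<Rightarrow> 'v) \<Rightarrow> (nat \<Rightarrow> 'v set) \<Rightarrow>
   (nat \<Rightarrow> nat \<Rightarrow> (int \<Rightarrow> int) \<Rightarrow> 'v \<Rightarrow> 'v) \<Rightarrow> nat \<Rightarrow> (int \<Rightarrow> int) \<Rightarrow> 'k" where
  "character scale V act n w = vector_space.trace_on scale (V n) (act n n w)"

text \<open>A signed cycle of \<open>w\<close> is given by its support, a cycle of the permutation \<open>i \<mapsto> \<bar>w i\<bar>\<close>
  of \<open>{1..n}\<close>; the signs it reverses are those of the \<open>i\<close> in the support with \<open>w i < 0\<close>.\<close>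

definition cycles :: "nat \<Rightarrow> (int \<Rightarrow> int) \<Rightarrow> int set set" where
  "cycles n w = (\<lambda>i. orbit (\<lambda>j. \<bar>w j\<bar>) i) ` {1..int n}"

definition sign_reversals :: "(int \<Rightarrow> int) \<Rightarrow> int set \<Rightarrow> nat" where
  "sign_reversals w C = card {i \<in> C. w i < 0}"

definition pos_cycles :: "nat \<Rightarrow> (int \<Rightarrow> int) \<Rightarrow> nat \<Rightarrow> nat" where
  "pos_cycles n w r = card {C \<in> cycles n w. card C = r \<and> even (sign_reversals w C)}"

definition neg_cycles :: "nat \<Rightarrow> (int \<Rightarrow> int) \<Rightarrow> nat \<Rightarrow> nat" where
  "neg_cycles n w r = card {C \<in> cycles n w. card C = r \<and> odd (sign_reversals w C)}"

datatype cvar = XVar nat | YVar nat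

fun cvar_index :: "cvar \<Rightarrow> nat" where
  "cvar_index (XVar r) = r"
| "cvar_index (YVar r) = r"

text \<open>Polynomials are finitely supported maps from monomials to coefficients, and monomials are
  finitely supported maps from variables to exponents. The variables of a character polynomial
  have index at least 1.\<close>

type_synonym 'k cpoly = "(cvar \<Rightarrow>\<^sub>0 nat) \<Rightarrow>\<^sub>0 'k"

definition character_polys :: "'k::field cpoly set" where
  "character_polys = {F. \<forall>m\<in>Poly_Mapping.keys F. \<forall>x\<in>Poly_Mapping.keys m. 1 \<le> cvar_index x}"

definition eval_cpoly :: "'k::field cpoly \<Rightarrow> (cvar \<Rightarrow> 'k) \<Rightarrow> 'k" where
  "eval_cpoly F \<phi> = (\<Sum>m\<in>Poly_Mapping.keys F. Poly_Mapping.lookup F m *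
     (\<Prod>x\<in>Poly_Mapping.keys m. \<phi> x ^ Poly_Mapping.lookup m x))"

definition monom_deg :: "(cvar \<Rightarrow>\<^sub>0 nat) \<Rightarrow> nat" where
  "monom_deg m = (\<Sum>x\<in>Poly_Mapping.keys m. Poly_Mapping.lookup m x * cvar_index x)"

definition cpoly_deg :: "'k::field cpoly \<Rightarrow> nat" where
  "cpoly_deg F = Max (insert 0 (monom_deg ` Poly_Mapping.keys F))"

fun cycle_count :: "nat \<Rightarrow> (int \<Rightarrow> int) \<Rightarrow> cvar \<Rightarrow> nat" where
  "cycle_count n w (XVar r) = pos_cycles n w r"
| "cycle_count n w (YVar r) = neg_cycles n w r"

definition cpoly_fun :: "'k::field cpoly \<Rightarrow> nat \<Rightarrow> (int \<Rightarrow> int) \<Rightarrow> 'k" where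
  "cpoly_fun F n w = eval_cpoly F (\<lambda>x. of_nat (cycle_count n w x))"

definition eval_X1 :: "'k::field cpoly \<Rightarrow> 'k \<Rightarrow> 'k" where
  "eval_X1 F t = eval_cpoly F ((\<lambda>_. 0)(XVar 1 := t))"

end

theory Submission
  imports Defs
begin

text \<open>
  A subset \<open>S\<close> of \<open>{1, \<dots>, n}\<close> gives a partial identity \<open>e\<^sub>S\<close> of the object \<open>n\<close>, which fixes
  \<open>\<plusminus>S\<close> and sends everything else to 0. These are commuting idempotents, so they
  split \<open>V\<^sub>n\<close> into summands \<open>E\<^sub>S\<close>, the images of the projections
  \<open>\<pi>\<^sub>S = \<Sum>\<^sub>T\<^sub>\<subseteq>\<^sub>S (-1)\<^bsup>|S| - |T|\<^esup> e\<^sub>T\<close>, and \<open>w\<close> in \<open>B\<^sub>n\<close> carries \<open>E\<^sub>S\<close> to \<open>E\<close>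
  of the image of \<open>S\<close> under \<open>|w|\<close>. Hence the trace of \<open>w\<close> is the sum of the traces of \<open>w\<close> on
  those \<open>E\<^sub>S\<close> whose index \<open>S\<close> is stable under \<open>|w|\<close>, that is, is a union of cycles of \<open>w\<close>.

  The trace on \<open>E\<^sub>S\<close> depends only on the signed cycle type of \<open>w\<close> on \<open>\<plusminus>S\<close>, because two
  signed permutations with the same cycle type are isomorphic, and an isomorphism between
  \<open>\<plusminus>S\<close> and \<open>\<plusminus>S'\<close>, extended by 0, is a morphism between the two objects
  (\<open>local_trace_eqI\<close>). It vanishes for \<open>|S| > d\<close>: \<open>V\<^sub>n\<close> is spanned by the images of \<open>V\<^sub>m\<close>,
  \<open>m \<le> d\<close>, under injections, whose ranges have the form \<open>\<plusminus>T\<close> with \<open>|T| \<le> d\<close>, and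
  \<open>\<pi>\<^sub>S\<close> kills these (\<open>local_trace_eq_0\<close>). The number of unions of cycles with \<open>\<tau> x\<close>
  cycles of each type \<open>x\<close> is a product of binomial coefficients in the cycle counts, so
  \<open>F = \<Sum>\<^sub>\<tau> a\<^sub>\<tau> \<Prod>\<^sub>x (x choose \<tau> x)\<close>, where \<open>\<tau>\<close> ranges over the types of total size at
  most \<open>d\<close>; this is a character polynomial of degree at most \<open>d\<close>
  (\<open>trace_function_eq_character_polynomial\<close>).

  All of this can be said about traces of single morphisms, without decomposing \<open>V\<^sub>n\<close>: the
  alternating sums of the traces of \<open>e\<^sub>T w\<close> over \<open>T \<subseteq> S\<close> stand for the traces on \<open>E\<^sub>S\<close>, and
  the identity \<open>tr (g f) = tr (f g)\<close> for morphisms \<open>f\<close>, \<open>g\<close> in opposite directions between two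
  objects does the rest.

  For uniqueness, every finitely supported family of cycle counts occurs for some \<open>n\<close> and \<open>w\<close>,
  and a polynomial over a field of characteristic zero is determined by its values at points with
  natural coordinates. The dimension is the trace of the identity, whose only nonzero cycle count
  is that of the positive 1-cycles, equal to \<open>n\<close>.
\<close>

section \<open>Traces on finite-dimensional subspaces\<close>

definition (in vector_space) basis_of :: "'b set \<Rightarrow> 'b set" where
  "basis_of W = (SOME B. independent B \<and> span B = W)"

definition (in vector_space) linear_on :: "'b set \<Rightarrow> ('b \<Rightarrow> 'b) \<Rightarrow> bool" where
  "linear_on W B \<longleftrightarrow> (\<forall>u\<in>W. \<forall>v\<in>W. B (u + v) = B u + B v) \<and>
     (\<forall>c. \<forall>v\<in>W. B (scale c v) = scale c (B v))"

context vector_space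
begin

lemma trace_on_basis_of:
  "trace_on W T = (\<Sum>b\<in>basis_of W. representation (basis_of W) (T b) b)"
  by (simp add: trace_on_def basis_of_def Let_def)

lemma basis_of_finite_dim:
  assumes "finite_dim_on W"
  shows "independent (basis_of W)" "span (basis_of W) = W" "finite (basis_of W)"
    "basis_of W \<subseteq> W"
proof -
  obtain G where G: "finite G" "span G = W"
    using assms by (auto simp: finite_dim_on_def)
  obtain B where B: "B \<subseteq> W" "independent B" "W \<subseteq> span B"
    by (rule maximal_independent_subset)
  have "span B = W"
    using B(1,3) G(2) span_minimal[OF B(1)] subspace_span by auto
  then have "independent (basis_of W) \<and> span (basis_of W) = W"
    unfolding basis_of_def using B(2) by (intro someI) auto
  then show ind: "independent (basis_of W)" and sp: "span (basis_of W) = W"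
    by auto
  show "basis_of W \<subseteq> W"
    using sp span_superset by blast
  then show "finite (basis_of W)"
    using independent_span_bound[OF G(1) ind] G(2) by auto
qed

lemma trace_on_cong:
  assumes "finite_dim_on W" "\<And>v. v \<in> W \<Longrightarrow> T v = T' v"
  shows "trace_on W T = trace_on W T'"
  unfolding trace_on_basis_of
  by (intro sum.cong refl) (use assms basis_of_finite_dim(4) in \<open>auto simp: subset_iff\<close>)

lemma trace_on_id:
  assumes "finite_dim_on W" "\<And>v. v \<in> W \<Longrightarrow> T v = v"
  shows "trace_on W T = of_nat (dim W)"
proof -
  note B = basis_of_finite_dim[OF assms(1)]
  have "trace_on W T = (\<Sum>b\<in>basis_of W. 1)"
    unfolding trace_on_basis_of
    by (intro sum.cong refl)
      (use assms B(1,4) in \<open>auto simp: subset_iff representation_basis\<close>)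
  moreover have "dim W = card (basis_of W)"
    using dim_span_eq_card_independent[OF B(1)] B(2) by simp
  ultimately show ?thesis
    by simp
qed

lemma linear_on_sum:
  assumes "finite_dim_on W" "linear_on W B" "finite I" "\<And>i. i \<in> I \<Longrightarrow> v i \<in> W"
  shows "B (\<Sum>i\<in>I. scale (c i) (v i)) = (\<Sum>i\<in>I. scale (c i) (B (v i)))"
  using assms(3,4)
proof (induction I)
  have W: "subspace W"
    using assms(1) by (auto simp: finite_dim_on_def)
  {
    case empty
    have "B (scale 0 0) = scale 0 (B 0)"
      using assms(2) subspace_0[OF W] unfolding linear_on_def by blast
    then show ?case by simp
  next
    case (insert i I)
    then have "scale (c i) (v i) \<in> W" "(\<Sum>i\<in>I. scale (c i) (v i)) \<in> W"
      by (auto intro!: subspace_sum[OF W] subspace_scale[OF W])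
    with insert assms(2) show ?case
      by (simp add: linear_on_def)
  }
qed

lemma representation_image:
  assumes fin: "finite_dim_on V" "finite_dim_on W"
    and a: "a \<in> W" and B: "\<And>v. v \<in> W \<Longrightarrow> B v \<in> V" "linear_on W B"
  shows "representation (basis_of V) (B a) b =
    (\<Sum>c\<in>basis_of W. representation (basis_of W) a c * representation (basis_of V) (B c) b)"
proof -
  note BV = basis_of_finite_dim[OF fin(1)] and BW = basis_of_finite_dim[OF fin(2)]
  have "a = (\<Sum>c\<in>basis_of W. scale (representation (basis_of W) a c) c)"
    using BW a by (intro sum_representation_eq[symmetric]) auto
  also have "B \<dots> = (\<Sum>c\<in>basis_of W. scale (representation (basis_of W) a c) (B c))"
    using BW(4) by (intro linear_on_sum[OF fin(2) B(2) BW(3)]) auto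
  finally have "B a = (\<Sum>c\<in>basis_of W. scale (representation (basis_of W) a c) (B c))" .
  moreover have "B c \<in> span (basis_of V)" if "c \<in> basis_of W" for c
    using that BW(4) B(1) BV(2) by auto
  ultimately show ?thesis
    using BV(1) by (simp add: representation_sum representation_scale span_scale)
qed

text \<open>With coordinates in the chosen bases of both spaces, both traces are the same double sum of
  products of matrix entries. Applied to an isomorphism and its inverse, this also shows that the
  trace does not depend on the chosen basis.\<close>

lemma trace_on_cyclic:
  assumes fin: "finite_dim_on V" "finite_dim_on W"
    and A: "\<And>v. v \<in> V \<Longrightarrow> A v \<in> W"
    and B: "\<And>v. v \<in> W \<Longrightarrow> B v \<in> V"
    and lin: "linear_on V A" "linear_on W B"
  shows "trace_on V (\<lambda>v. B (A v)) = trace_on W (\<lambda>v. A (B v))"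
proof -
  note BV = basis_of_finite_dim[OF fin(1)] and BW = basis_of_finite_dim[OF fin(2)]
  have "trace_on V (\<lambda>v. B (A v)) = (\<Sum>b\<in>basis_of V. \<Sum>c\<in>basis_of W.
      representation (basis_of W) (A b) c * representation (basis_of V) (B c) b)"
    unfolding trace_on_basis_of using BV(4)
    by (intro sum.cong refl representation_image fin A B lin) auto
  also have "\<dots> = (\<Sum>c\<in>basis_of W. \<Sum>b\<in>basis_of V.
      representation (basis_of V) (B c) b * representation (basis_of W) (A b) c)"
    by (subst sum.swap) (simp add: mult.commute)
  also have "\<dots> = trace_on W (\<lambda>v. A (B v))"
    unfolding trace_on_basis_of using BW(4)
    by (intro sum.cong refl representation_image[symmetric] fin A B lin) auto
  finally show ?thesis .
qed

end

lemma (in kmod_functor) trace_act_cyclic: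
  assumes "\<And>n. finite_dim_on (V n)" "f \<in> Hom m n" "g \<in> Hom n m"
  shows "trace_on (V m) (act m m (compose (Obj m) g f))
    = trace_on (V n) (act n n (compose (Obj n) f g))"
proof -
  have "trace_on (V m) (act m m (compose (Obj m) g f)) = trace_on (V m) (\<lambda>v. act n m g (act m n f v))"
    using assms by (intro trace_on_cong) (auto simp: act_comp)
  also have "\<dots> = trace_on (V n) (\<lambda>v. act m n f (act n m g v))"
    using assms by (intro trace_on_cyclic act_in) (simp_all add: linear_on_def act_add act_scale)
  also have "\<dots> = trace_on (V n) (act n n (compose (Obj n) f g))"
    using assms by (intro trace_on_cong) (auto simp: act_comp)
  finally show ?thesis .
qed

section \<open>Morphisms of \<open>FI\<^sub>B\<^sub>C\<sharp>\<close>\<close>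

lemma FIBC_sharpI:
  assumes "f \<in> extensional (signed0 m)"
    and "\<And>a. a \<in> signed0 m \<Longrightarrow> f a \<in> signed0 n"
    and "\<And>a. a \<in> signed0 m \<Longrightarrow> f (- a) = - f a"
    and inj: "\<And>a b. a \<in> signed0 m \<Longrightarrow> b \<in> signed0 m \<Longrightarrow> f a = f b \<Longrightarrow> f b \<noteq> 0 \<Longrightarrow> a = b"
  shows "f \<in> FIBC_sharp m n"
proof -
  have "card {a \<in> signed0 m. f a = b} \<le> 1" if "1 \<le> \<bar>b\<bar>" for b
  proof -
    have "finite {a \<in> signed0 m. f a = b}"
      by (rule finite_subset[of _ "signed0 m"]) (auto simp: signed0_def)
    then show ?thesis
      using inj that by (fastforce simp: card_le_Suc0_iff_eq)
  qed
  with assms(1-3) show ?thesis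
    by (auto simp: FIBC_sharp_def PiE_def)
qed

lemma signed0_zero [simp]: "0 \<in> signed0 n"
  by (simp add: signed0_def)

lemma uminus_signed0 [simp]: "- x \<in> signed0 n \<longleftrightarrow> x \<in> signed0 n"
  by (auto simp: signed0_def)

lemma uminus_signed [simp]: "- x \<in> signed n \<longleftrightarrow> x \<in> signed n"
  by (auto simp: signed_def)

lemma signed_iff_abs: "x \<in> signed n \<longleftrightarrow> \<bar>x\<bar> \<in> {1..int n}"
  by (auto simp: signed_def)

lemma signed_iff_signed0: "x \<in> signed n \<longleftrightarrow> x \<in> signed0 n \<and> x \<noteq> 0"
  by (auto simp: signed_def signed0_def)

lemma finite_signed [simp]: "finite (signed n)"
  by (simp add: signed_def)

lemma signed_permsD:
  assumes "w \<in> signed_perms n"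
  shows "x \<in> signed n \<Longrightarrow> w x \<in> signed n"
    and "x \<in> signed n \<Longrightarrow> w (- x) = - w x"
    and "x \<in> signed n \<Longrightarrow> y \<in> signed n \<Longrightarrow> w x = w y \<Longrightarrow> x = y"
    and "x \<in> signed n \<Longrightarrow> \<bar>w \<bar>x\<bar>\<bar> = \<bar>w x\<bar>"
  using assms by (auto simp: signed_perms_def bij_betw_def inj_on_def abs_if)

definition partial_id :: "nat \<Rightarrow> int set \<Rightarrow> int \<Rightarrow> int" where
  "partial_id n T = (\<lambda>x\<in>signed0 n. if \<bar>x\<bar> \<in> T then x else 0)"

text \<open>The composite of \<open>w\<close> with the partial identity that sends everything outside
  \<open>\<plusminus>T\<close> to 0.\<close>

definition cut :: "nat \<Rightarrow> (int \<Rightarrow> int) \<Rightarrow> int set \<Rightarrow> int \<Rightarrow> int" where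
  "cut n w T = (\<lambda>x\<in>signed0 n. if x \<noteq> 0 \<and> \<bar>w x\<bar> \<in> T then w x else 0)"

lemma partial_id_in_FIBC_sharp: "partial_id n T \<in> FIBC_sharp n n"
  by (rule FIBC_sharpI) (auto simp: partial_id_def split: if_splits)

lemma cut_in_FIBC_sharp:
  assumes w: "w \<in> signed_perms n"
  shows "cut n w T \<in> FIBC_sharp n n"
proof (rule FIBC_sharpI)
  show "cut n w T a \<in> signed0 n" if "a \<in> signed0 n" for a
    using signed_permsD(1)[OF w] that by (auto simp: cut_def signed_iff_signed0)
  show "cut n w T (- a) = - cut n w T a" if "a \<in> signed0 n" for a
    using signed_permsD(2)[OF w, of a] that by (auto simp: cut_def signed_iff_signed0)
  show "a = b" if "a \<in> signed0 n" "b \<in> signed0 n" "cut n w T a = cut n w T b" "cut n w T b \<noteq> 0" for a b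
    using signed_permsD(3)[OF w, of a b] that
    by (auto simp: cut_def signed_iff_signed0 split: if_splits)
qed (simp add: cut_def)

lemma cut_full:
  assumes w: "w \<in> signed_perms n"
  shows "cut n w {1..int n} = extend0 n w"
proof
  show "cut n w {1..int n} x = extend0 n w x" for x
    using signed_permsD(1)[OF w, of x]
    by (auto simp: cut_def extend0_def signed_def signed0_def)
qed

lemma compose_partial_id_cut:
  assumes w: "w \<in> signed_perms n"
  shows "compose (signed0 n) (partial_id n T) (cut n w U) = cut n w (T \<inter> U)"
proof
  show "compose (signed0 n) (partial_id n T) (cut n w U) x = cut n w (T \<inter> U) x" for x
    using signed_permsD(1)[OF w, of x]
    by (auto simp: cut_def partial_id_def compose_def signed_iff_signed0)
qed

section \<open>Alternating sums of trace functions\<close>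

text \<open>The subsets with and without \<open>i\<close> cancel in pairs. This gives both vanishing results: for
  unstable \<open>S\<close>, and for \<open>S\<close> larger than the degree of generation.\<close>

lemma alternating_sum_eq_0:
  fixes f :: "'a set \<Rightarrow> 'b::comm_ring_1"
  assumes "finite S" "i \<in> S" "\<And>T. T \<subseteq> S \<Longrightarrow> f (insert i T) = f T"
  shows "(\<Sum>T\<in>Pow S. (-1) ^ card T * f T) = 0"
proof -
  define S' where "S' = S - {i}"
  have S: "S = insert i S'" "i \<notin> S'" "finite S'"
    using assms by (auto simp: S'_def)
  have inj: "inj_on (insert i) (Pow S')"
    using S(2) by (auto simp: inj_on_def)
  have "(\<Sum>T\<in>Pow S. (-1) ^ card T * f T) = (\<Sum>T\<in>Pow S'. (-1) ^ card T * f T) +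
      (\<Sum>T\<in>Pow S'. (-1) ^ card (insert i T) * f (insert i T))"
    unfolding S(1) Pow_insert using S(2,3) inj
    by (subst sum.union_disjoint) (auto simp: sum.reindex)
  also have "(\<Sum>T\<in>Pow S'. (-1) ^ card (insert i T) * f (insert i T)) =
      (\<Sum>T\<in>Pow S'. - ((-1) ^ card T * f T))"
  proof (intro sum.cong refl)
    fix T assume T: "T \<in> Pow S'"
    then have "finite T" "i \<notin> T" "T \<subseteq> S"
      using S finite_subset by auto
    then show "(-1) ^ card (insert i T) * f (insert i T) = - ((-1) ^ card T * f T)"
      using assms(3)[of T] by simp
  qed
  finally show ?thesis
    by (simp add: sum_negf)
qed

text \<open>The properties of \<open>f \<mapsto> tr (V f)\<close> that the combinatorial part of the proof
  uses are captured by one identity. It plays the role of conjugation invariance, but it compares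
  endomorphisms of different objects.\<close>

locale trace_function =
  fixes \<theta> :: "nat \<Rightarrow> (int \<Rightarrow> int) \<Rightarrow> 'k::comm_ring_1"
  assumes cyclic: "f \<in> FIBC_sharp m n \<Longrightarrow> g \<in> FIBC_sharp n m \<Longrightarrow>
    \<theta> m (compose (signed0 m) g f) = \<theta> n (compose (signed0 n) f g)"
begin

text \<open>If \<open>\<theta>\<close> is the trace on \<open>V\<close>, then up to the sign \<open>(-1) ^ card S\<close> this is the trace of
  \<open>\<pi>\<^sub>S w\<close>. Leaving the sign out makes the inversion formula symmetric.\<close>

definition local_trace :: "nat \<Rightarrow> (int \<Rightarrow> int) \<Rightarrow> int set \<Rightarrow> 'k" where
  "local_trace n w S = (\<Sum>T\<in>Pow S. (-1) ^ card T * \<theta> n (cut n w T))"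

lemma trace_eq_sum_local_trace:
  assumes "w \<in> signed_perms n"
  shows "\<theta> n (extend0 n w) = (\<Sum>S\<in>Pow {1..int n}. (-1) ^ card S * local_trace n w S)"
  using inclusion_exclusion_symmetric[of "local_trace n w" "\<lambda>T. \<theta> n (cut n w T)" "{1..int n}"] assms
  by (simp add: local_trace_def cut_full)

text \<open>If \<open>i \<in> S\<close> is not the image of a point of \<open>S\<close>, then the trace of \<open>w\<close>
  cut down to any \<open>T \<subseteq> S\<close> does not change when \<open>i\<close> is added to \<open>T\<close>: by cyclicity the
  domain can be cut down to \<open>T \<union> {i}\<close> as well, and then the value \<open>i\<close> is not attained.\<close>

lemma local_trace_unstable:
  assumes w: "w \<in> signed_perms n" and "finite S" and i: "i \<in> S" "i \<notin> (\<lambda>j. \<bar>w j\<bar>) ` S"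
  shows "local_trace n w S = 0"
  unfolding local_trace_def
proof (rule alternating_sum_eq_0[OF \<open>finite S\<close> i(1)])
  fix T assume "T \<subseteq> S"
  let ?p = "partial_id n (insert i T)"
  have "\<theta> n (cut n w (insert i T)) = \<theta> n (compose (signed0 n) ?p (cut n w (insert i T)))"
    by (simp add: compose_partial_id_cut[OF w])
  also have "\<dots> = \<theta> n (compose (signed0 n) (cut n w (insert i T)) ?p)"
    by (intro cyclic partial_id_in_FIBC_sharp cut_in_FIBC_sharp w)
  also have "compose (signed0 n) (cut n w (insert i T)) ?p = compose (signed0 n) (cut n w T) ?p"
  proof
    fix x
    have "\<bar>w x\<bar> \<noteq> i" if "x \<in> signed n" "\<bar>x\<bar> \<in> insert i T"
    proof -
      have "\<bar>w \<bar>x\<bar>\<bar> \<in> (\<lambda>j. \<bar>w j\<bar>) ` S"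
        using that(2) i(1) \<open>T \<subseteq> S\<close> by auto
      with i(2) show ?thesis
        using signed_permsD(4)[OF w that(1)] by auto
    qed
    then show "compose (signed0 n) (cut n w (insert i T)) ?p x = compose (signed0 n) (cut n w T) ?p x"
      by (auto simp: compose_def cut_def partial_id_def signed_iff_signed0)
  qed
  also have "\<theta> n \<dots> = \<theta> n (compose (signed0 n) ?p (cut n w T))"
    by (intro cyclic[symmetric] partial_id_in_FIBC_sharp cut_in_FIBC_sharp w)
  also have "\<dots> = \<theta> n (cut n w T)"
    by (simp add: compose_partial_id_cut[OF w] Int_absorb1 subset_insertI)
  finally show "\<theta> n (cut n w (insert i T)) = \<theta> n (cut n w T)" .
qed

text \<open>An isomorphism \<open>h\<close> of \<open>w\<close> on \<open>\<plusminus>S\<close> with \<open>w'\<close> on \<open>\<plusminus>S'\<close>, extended by 0,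
  and its inverse are morphisms of \<open>FI\<^sub>B\<^sub>C\<sharp>\<close> between the two objects; cyclicity for these
  compares the traces.\<close>

lemma trace_cut_conjugate:
  assumes w: "w \<in> signed_perms n" and w': "w' \<in> signed_perms n'"
    and S: "S \<subseteq> {1..int n}" and S': "S' \<subseteq> {1..int n'}"
    and h: "bij_betw h {x. \<bar>x\<bar> \<in> S} {x. \<bar>x\<bar> \<in> S'}"
    and odd: "\<And>x. \<bar>x\<bar> \<in> S \<Longrightarrow> h (- x) = - h x"
    and stable: "\<And>x. x \<in> signed n \<Longrightarrow> \<bar>w x\<bar> \<in> S \<longleftrightarrow> \<bar>x\<bar> \<in> S"
    and stable': "\<And>x. x \<in> signed n' \<Longrightarrow> \<bar>w' x\<bar> \<in> S' \<longleftrightarrow> \<bar>x\<bar> \<in> S'"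
    and hw: "\<And>x. \<bar>x\<bar> \<in> S \<Longrightarrow> h (w x) = w' (h x)"
    and "T \<subseteq> S"
  shows "\<theta> n (cut n w T) = \<theta> n' (cut n' w' ((\<lambda>j. \<bar>h j\<bar>) ` T))"
proof -
  define T' where "T' = (\<lambda>j. \<bar>h j\<bar>) ` T"
  define g where "g = inv_into {x. \<bar>x\<bar> \<in> S} h"
  have h_in: "\<bar>h x\<bar> \<in> S'" if "\<bar>x\<bar> \<in> S" for x
    using that h by (auto simp: bij_betw_def)
  have g_in: "\<bar>g y\<bar> \<in> S" if "\<bar>y\<bar> \<in> S'" for y
    using that h bij_betw_inv_into[OF h] by (auto simp: bij_betw_def g_def)
  have gh: "g (h x) = x" if "\<bar>x\<bar> \<in> S" for x
    unfolding g_def using that bij_betw_inv_into_left[OF h] by simp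
  have hg: "h (g y) = y" if "\<bar>y\<bar> \<in> S'" for y
    unfolding g_def using that bij_betw_inv_into_right[OF h] by simp
  have g_odd: "g (- y) = - g y" if "\<bar>y\<bar> \<in> S'" for y
    using odd[of "g y"] g_in[OF that] hg[OF that] gh[of "- g y"] by simp
  have g_inj: "x = y" if "\<bar>x\<bar> \<in> S'" "\<bar>y\<bar> \<in> S'" "g x = g y" for x y
    using that hg by metis
  have h_inj: "x = y" if "\<bar>x\<bar> \<in> S" "\<bar>y\<bar> \<in> S" "h x = h y" for x y
    using that gh by metis
  have T'_iff: "\<bar>h x\<bar> \<in> T' \<longleftrightarrow> \<bar>x\<bar> \<in> T" if x: "\<bar>x\<bar> \<in> S" for x
  proof
    assume "\<bar>h x\<bar> \<in> T'"
    then obtain t where t: "t \<in> T" "\<bar>h x\<bar> = \<bar>h t\<bar>"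
      by (auto simp: T'_def)
    then have "t \<in> S" "t > 0"
      using \<open>T \<subseteq> S\<close> S by auto
    moreover from t(2) have "h x = h t \<or> h x = h (- t)"
      using odd[of t] \<open>t \<in> S\<close> \<open>t > 0\<close> by (simp add: abs_eq_iff)
    ultimately have "x = t \<or> x = - t"
      using h_inj[of x t] h_inj[of x "- t"] x by auto
    with t(1) \<open>t > 0\<close> show "\<bar>x\<bar> \<in> T" by auto
  next
    assume "\<bar>x\<bar> \<in> T"
    moreover have "\<bar>h \<bar>x\<bar>\<bar> = \<bar>h x\<bar>"
      using odd[OF x] by (simp add: abs_if)
    ultimately show "\<bar>h x\<bar> \<in> T'"
      unfolding T'_def by (auto simp: image_iff intro!: bexI[of _ "\<bar>x\<bar>"])
  qed
  have pos: "x \<in> signed n" if "\<bar>x\<bar> \<in> S" for x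
    using that S by (auto simp: signed_iff_abs)
  have pos': "x \<in> signed n'" if "\<bar>x\<bar> \<in> S'" for x
    using that S' by (auto simp: signed_iff_abs)
  have T'S': "T' \<subseteq> S'"
    using h_in \<open>T \<subseteq> S\<close> S by (force simp: T'_def)
  have nz: "0 \<notin> S" "0 \<notin> S'" "0 \<notin> T'"
    using S S' T'S' by auto
  (* p extends the inverse of h by 0, and q is the composite of w, the extension of h and the
     partial identity on T'. In one order they compose to w cut down to T, in the other to w'
     cut down to T'. *)
  define p where "p = (\<lambda>y\<in>signed0 n'. if \<bar>y\<bar> \<in> S' then g y else 0)"
  define q where "q = (\<lambda>x\<in>signed0 n. if x \<noteq> 0 \<and> \<bar>w x\<bar> \<in> T then h (w x) else 0)"
  have p: "p \<in> FIBC_sharp n' n"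
    by (rule FIBC_sharpI)
      (use g_in pos g_odd g_inj in \<open>auto simp: p_def signed_iff_signed0 split: if_splits\<close>)
  have q: "q \<in> FIBC_sharp n n'"
  proof (rule FIBC_sharpI)
    show "q a \<in> signed0 n'" if "a \<in> signed0 n" for a
      using that h_in[of "w a"] pos'[of "h (w a)"] \<open>T \<subseteq> S\<close> by (auto simp: q_def signed_iff_signed0)
    show "q (- a) = - q a" if "a \<in> signed0 n" for a
      using that odd[of "w a"] signed_permsD(2)[OF w, of a] \<open>T \<subseteq> S\<close>
      by (auto simp: q_def signed_iff_signed0)
    show "a = b" if "a \<in> signed0 n" "b \<in> signed0 n" "q a = q b" "q b \<noteq> 0" for a b
      using that h_inj[of "w a" "w b"] signed_permsD(3)[OF w, of a b] \<open>T \<subseteq> S\<close>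
      by (auto simp: q_def signed_iff_signed0 split: if_splits)
  qed (simp add: q_def)
  have pq: "compose (signed0 n) p q = cut n w T"
  proof
    fix x
    show "compose (signed0 n) p q x = cut n w T x"
      using h_in[of "w x"] gh[of "w x"] pos'[of "h (w x)"] \<open>T \<subseteq> S\<close> nz
      by (auto simp: compose_def p_def q_def cut_def signed_iff_signed0)
  qed
  have qp: "compose (signed0 n') q p = cut n' w' T'"
  proof
    fix y
    show "compose (signed0 n') q p y = cut n' w' T' y"
    proof (cases "y \<in> signed0 n' \<and> y \<noteq> 0")
      case False
      then show ?thesis
        using nz by (auto simp: compose_def p_def q_def cut_def)
    next
      case True
      then have y: "y \<in> signed n'"
        by (simp add: signed_iff_signed0)
      show ?thesis
      proof (cases "\<bar>y\<bar> \<in> S'")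
        case False
        then have "\<bar>w' y\<bar> \<notin> T'"
          using stable'[OF y] T'S' by auto
        with False True show ?thesis
          by (simp add: compose_def p_def q_def cut_def)
      next
        case y': True
        have "\<bar>g y\<bar> \<in> S" "h (w (g y)) = w' y" "\<bar>w (g y)\<bar> \<in> S"
          using g_in[OF y'] hw[of "g y"] hg[OF y'] stable[of "g y"] pos by auto
        then show ?thesis
          using True y' T'_iff[of "w (g y)"] pos[of "g y"]
          by (auto simp: compose_def p_def q_def cut_def signed_iff_signed0)
      qed
    qed
  qed
  show ?thesis
    using cyclic[OF q p] pq qp by (simp add: T'_def)
qed

text \<open>The map \<open>\<bar>h\<bar>\<close> is a bijection from \<open>S\<close> to \<open>S'\<close>, hence matches the terms of the two
  alternating sums.\<close>

lemma local_trace_conjugate: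
  assumes w: "w \<in> signed_perms n" and w': "w' \<in> signed_perms n'"
    and S: "S \<subseteq> {1..int n}" and S': "S' \<subseteq> {1..int n'}"
    and h: "bij_betw h {x. \<bar>x\<bar> \<in> S} {x. \<bar>x\<bar> \<in> S'}"
    and odd: "\<And>x. \<bar>x\<bar> \<in> S \<Longrightarrow> h (- x) = - h x"
    and stable: "\<And>x. x \<in> signed n \<Longrightarrow> \<bar>w x\<bar> \<in> S \<longleftrightarrow> \<bar>x\<bar> \<in> S"
    and stable': "\<And>x. x \<in> signed n' \<Longrightarrow> \<bar>w' x\<bar> \<in> S' \<longleftrightarrow> \<bar>x\<bar> \<in> S'"
    and hw: "\<And>x. \<bar>x\<bar> \<in> S \<Longrightarrow> h (w x) = w' (h x)"
  shows "local_trace n w S = local_trace n' w' S'"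
proof -
  have bij: "bij_betw (\<lambda>j. \<bar>h j\<bar>) S S'"
  proof (rule bij_betwI')
    have pos: "x > 0" "\<bar>x\<bar> \<in> S" if "x \<in> S" for x
      using that S by auto
    show "\<bar>h x\<bar> \<in> S'" if "x \<in> S" for x
      using pos[OF that] h by (auto simp: bij_betw_def)
    show "(\<bar>h x\<bar> = \<bar>h y\<bar>) = (x = y)" if "x \<in> S" "y \<in> S" for x y
    proof
      assume "\<bar>h x\<bar> = \<bar>h y\<bar>"
      then have "h x = h y \<or> h x = h (- y)"
        using odd pos that by (auto simp: abs_eq_iff)
      then have "x = y \<or> x = - y"
        using inj_onD[OF bij_betw_imp_inj_on[OF h], of x y]
          inj_onD[OF bij_betw_imp_inj_on[OF h], of x "- y"] pos[OF that(1)] pos[OF that(2)]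
        by auto
      then show "x = y"
        using pos(1)[OF that(1)] pos(1)[OF that(2)] by linarith
    qed simp
    show "\<exists>x\<in>S. y = \<bar>h x\<bar>" if "y \<in> S'" for y
    proof -
      have "y \<in> h ` {x. \<bar>x\<bar> \<in> S}" "y > 0"
        using h that S' by (auto simp: bij_betw_def)
      then obtain x where x: "\<bar>x\<bar> \<in> S" "y = h x"
        by auto
      then have "y = \<bar>h \<bar>x\<bar>\<bar>"
        using odd[OF x(1)] \<open>y > 0\<close> by (simp add: abs_if)
      with x show ?thesis
        by (intro bexI[of _ "\<bar>x\<bar>"]) auto
    qed
  qed
  have "local_trace n w S =
      (\<Sum>T\<in>Pow S. (-1) ^ card ((\<lambda>j. \<bar>h j\<bar>) ` T) * \<theta> n' (cut n' w' ((\<lambda>j. \<bar>h j\<bar>) ` T)))"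
    unfolding local_trace_def
  proof (intro sum.cong refl)
    fix T assume "T \<in> Pow S"
    moreover from this have "card ((\<lambda>j. \<bar>h j\<bar>) ` T) = card T"
      using bij by (intro card_image) (auto simp: bij_betw_def inj_on_def)
    ultimately show "(-1) ^ card T * \<theta> n (cut n w T) =
        (-1) ^ card ((\<lambda>j. \<bar>h j\<bar>) ` T) * \<theta> n' (cut n' w' ((\<lambda>j. \<bar>h j\<bar>) ` T))"
      using trace_cut_conjugate[OF assms, of T] by simp
  qed
  also have "\<dots> = local_trace n' w' S'"
    unfolding local_trace_def
    by (rule sum.reindex_bij_betw[OF bij_betw_Pow[OF bij],
        where g = "\<lambda>T. (-1) ^ card T * \<theta> n' (cut n' w' T)"])
  finally show ?thesis .
qed

end

section \<open>Signed cycles\<close>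

abbreviation abs_perm :: "(int \<Rightarrow> int) \<Rightarrow> int \<Rightarrow> int" where
  "abs_perm w \<equiv> \<lambda>j. \<bar>w j\<bar>"

text \<open>The type of a signed cycle is the variable that counts cycles of its length and sign.\<close>

definition cycle_type :: "(int \<Rightarrow> int) \<Rightarrow> int set \<Rightarrow> cvar" where
  "cycle_type w C = (if even (sign_reversals w C) then XVar (card C) else YVar (card C))"

definition type_count :: "(int \<Rightarrow> int) \<Rightarrow> int set set \<Rightarrow> cvar \<Rightarrow> nat" where
  "type_count w D x = card {C \<in> D. cycle_type w C = x}"

lemma cycle_count_eq_type_count: "cycle_count n w x = type_count w (cycles n w) x"
  by (cases x) (auto simp: pos_cycles_def neg_cycles_def type_count_def cycle_type_def
      intro!: arg_cong[of _ _ card])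

lemma cvar_index_cycle_type [simp]: "cvar_index (cycle_type w C) = card C"
  by (simp add: cycle_type_def)

lemma abs_perm_bij:
  assumes w: "w \<in> signed_perms n"
  shows "bij_betw (abs_perm w) {1..int n} {1..int n}"
proof -
  have mem: "x \<in> signed n" if "x \<in> {1..int n}" for x
    using that by (simp add: signed_iff_abs)
  have "abs_perm w ` {1..int n} \<subseteq> {1..int n}"
    using signed_permsD(1)[OF w] mem signed_iff_abs by blast
  moreover have "inj_on (abs_perm w) {1..int n}"
  proof (rule inj_onI)
    fix x y assume xy: "x \<in> {1..int n}" "y \<in> {1..int n}" "\<bar>w x\<bar> = \<bar>w y\<bar>"
    then have "w x = w y \<or> w x = w (- y)"
      using signed_permsD(2)[OF w, of y] mem by (auto simp: abs_eq_iff)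
    then have "x = y \<or> x = - y"
      using signed_permsD(3)[OF w, of x y] signed_permsD(3)[OF w, of x "- y"] mem xy(1,2) by auto
    with xy(1,2) show "x = y" by auto
  qed
  ultimately show ?thesis
    by (simp add: bij_betw_def endo_inj_surj)
qed

lemma orbit_cycles:
  assumes w: "w \<in> signed_perms n"
  shows "i \<in> {1..int n} \<Longrightarrow> orbit (abs_perm w) i \<in> cycles n w"
    and "i \<in> {1..int n} \<Longrightarrow> i \<in> orbit (abs_perm w) i"
    and "C \<in> cycles n w \<Longrightarrow> C \<subseteq> {1..int n}"
    and "C \<in> cycles n w \<Longrightarrow> i \<in> C \<Longrightarrow> orbit (abs_perm w) i = C"
proof -
  define p where "p = perm_restrict (abs_perm w) {1..int n}"
  have "bij_betw p {1..int n} {1..int n}"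
    using abs_perm_bij[OF w] by (subst bij_betw_cong[of _ _ "abs_perm w"]) (auto simp: p_def perm_restrict_def)
  then have p: "p permutes {1..int n}"
    by (rule bij_imp_permutes) (auto simp: p_def perm_restrict_def)
  then have perm: "permutation p"
    by (auto simp: permutation_permutes)
  have eq: "orbit (abs_perm w) i = orbit p i" if "i \<in> {1..int n}" for i
    using that abs_perm_bij[OF w]
    by (intro orbit_cong0[of i "{1..int n}"]) (auto simp: bij_betw_def p_def perm_restrict_def)
  show "i \<in> {1..int n} \<Longrightarrow> orbit (abs_perm w) i \<in> cycles n w"
    by (simp add: cycles_def)
  show "i \<in> {1..int n} \<Longrightarrow> i \<in> orbit (abs_perm w) i"
    using permutation_self_in_orbit[OF perm] by (simp add: eq)
  show sub: "C \<subseteq> {1..int n}" if C: "C \<in> cycles n w" for C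
  proof -
    obtain j where j: "j \<in> {1..int n}" "C = orbit (abs_perm w) j"
      using C unfolding cycles_def by blast
    then show ?thesis
      using permutes_orbit_subset[OF p j(1)] eq[OF j(1)] by simp
  qed
  show "orbit (abs_perm w) i = C" if C: "C \<in> cycles n w" "i \<in> C"
  proof -
    obtain j where j: "j \<in> {1..int n}" "C = orbit (abs_perm w) j"
      using C(1) unfolding cycles_def by blast
    have i: "i \<in> {1..int n}"
      using sub C by blast
    show ?thesis
      using orbit_cyclic_eq3[OF cyclic_on_orbit'[OF perm], of i j] C(2) j(2) eq[OF i] eq[OF j(1)]
      by simp
  qed
qed

lemma finite_cycles [simp]: "finite (cycles n w)"
  by (simp add: cycles_def)

lemma cycles_finite_card:
  assumes "w \<in> signed_perms n" "C \<in> cycles n w"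
  shows "finite C" "C \<noteq> {}" "card C > 0"
proof -
  show "finite C"
    using orbit_cycles(3)[OF assms] finite_subset by auto
  moreover show "C \<noteq> {}"
    using assms(2) orbit_nonempty by (force simp: cycles_def)
  ultimately show "card C > 0"
    by (simp add: card_gt_0_iff)
qed

lemma cycles_disjoint:
  assumes "w \<in> signed_perms n" "C \<in> cycles n w" "C' \<in> cycles n w" "i \<in> C" "i \<in> C'"
  shows "C = C'"
  using orbit_cycles(4)[OF assms(1)] assms(2-5) by metis

text \<open>The points \<open>|x|\<close> and \<open>|w x|\<close> lie in the same orbit, hence in the same cycle.\<close>

lemma Union_cycles_stable:
  assumes w: "w \<in> signed_perms n" and D: "D \<subseteq> cycles n w" and x: "x \<in> signed n"
  shows "\<bar>w x\<bar> \<in> \<Union>D \<longleftrightarrow> \<bar>x\<bar> \<in> \<Union>D"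
proof -
  have x': "\<bar>x\<bar> \<in> {1..int n}"
    using x by (simp add: signed_iff_abs)
  have wx: "\<bar>w x\<bar> \<in> orbit (abs_perm w) \<bar>x\<bar>"
    using orbit.base[of "abs_perm w" "\<bar>x\<bar>"] signed_permsD(4)[OF w x] by simp
  have "\<bar>w x\<bar> \<in> C \<longleftrightarrow> \<bar>x\<bar> \<in> C" if "C \<in> D" for C
    using cycles_disjoint[OF w, of C "orbit (abs_perm w) \<bar>x\<bar>"] that D wx
      orbit_cycles(1,2)[OF w x'] by blast
  then show ?thesis by auto
qed

text \<open>By finiteness, a set contained in its image is equal to it, hence contains the orbits of its
  points.\<close>

lemma stable_eq_Union_cycles:
  assumes w: "w \<in> signed_perms n" and S: "S \<subseteq> {1..int n}" "S \<subseteq> abs_perm w ` S"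
  shows "S = \<Union>{C \<in> cycles n w. C \<subseteq> S}"
proof -
  have inj: "inj_on (abs_perm w) S"
    using abs_perm_bij[OF w] S(1) by (auto simp: bij_betw_def inj_on_def)
  have "finite S"
    using S(1) finite_subset by auto
  then have "abs_perm w ` S = S"
    using S(2) card_image[OF inj] by (intro card_subset_eq[symmetric]) auto
  then have "orbit (abs_perm w) i \<subseteq> S" if "i \<in> S" for i
  proof -
    have "y \<in> S" if "y \<in> orbit (abs_perm w) i" for y
      using that \<open>abs_perm w ` S = S\<close> \<open>i \<in> S\<close> by induction auto
    then show ?thesis by auto
  qed
  then have "i \<in> \<Union>{C \<in> cycles n w. C \<subseteq> S}" if "i \<in> S" for i
    using orbit_cycles(1,2)[OF w, of i] that S(1)
    by (intro UnionI[of "orbit (abs_perm w) i"] CollectI conjI) auto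
  then show ?thesis by auto
qed

lemma inj_on_Union_cycles:
  assumes w: "w \<in> signed_perms n"
  shows "inj_on Union (Pow (cycles n w))"
proof -
  have "D \<subseteq> D'" if D: "D \<subseteq> cycles n w" "D' \<subseteq> cycles n w" "\<Union>D = \<Union>D'" for D D'
  proof
    fix C assume C: "C \<in> D"
    obtain i where i: "i \<in> C"
      using cycles_finite_card(2)[OF w, of C] D(1) C by auto
    then have "i \<in> \<Union>D'"
      using D(3) C by auto
    then obtain C' where "C' \<in> D'" "i \<in> C'"
      by auto
    then show "C \<in> D'"
      using cycles_disjoint[OF w, of C C' i] i C D(1,2) by auto
  qed
  then show ?thesis
    by (intro inj_onI) (simp add: subset_antisym)
qed

lemma card_Union_cycles:
  assumes w: "w \<in> signed_perms n" and D: "D \<subseteq> cycles n w"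
  shows "card (\<Union>D) = (\<Sum>C\<in>D. card C)"
proof (rule card_Union_disjoint)
  show "pairwise disjnt D"
    using cycles_disjoint[OF w] D unfolding pairwise_def disjnt_def by blast
  show "finite C" if "C \<in> D" for C
    using cycles_finite_card(1)[OF w, of C] that D by auto
qed

section \<open>Cycles of equal type are isomorphic\<close>

lemma funpow_signed_perm:
  assumes w: "w \<in> signed_perms n" and i: "i \<in> {1..int n}"
  shows "(w ^^ j) i \<in> signed n" "\<bar>(w ^^ j) i\<bar> = (abs_perm w ^^ j) i"
    "(w ^^ j) i = (\<Prod>l<j. sgn (w ((abs_perm w ^^ l) i))) * (abs_perm w ^^ j) i"
proof -
  have "(w ^^ j) i \<in> signed n \<and> \<bar>(w ^^ j) i\<bar> = (abs_perm w ^^ j) i \<and>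
    (w ^^ j) i = (\<Prod>l<j. sgn (w ((abs_perm w ^^ l) i))) * (abs_perm w ^^ j) i"
  proof (induction j)
    case 0
    then show ?case
      using i by (simp add: signed_iff_abs)
  next
    case (Suc j)
    let ?y = "(abs_perm w ^^ j) i" and ?P = "\<Prod>l<j. sgn (w ((abs_perm w ^^ l) i))"
    let ?z = "(w ^^ j) i"
    have z: "?z \<in> signed n" "\<bar>?z\<bar> = ?y" "?z = ?P * ?y"
      using Suc by blast+
    then have y: "?y \<in> signed n" "?y > 0"
      by (auto simp: signed_iff_abs)
    have "\<bar>?P * ?y\<bar> = ?y"
      using z by metis
    then have "?P = 1 \<or> ?P = - 1"
      using y(2) by (auto simp: abs_mult abs_eq_iff')
    then have "w (?P * ?y) = ?P * w ?y"
      using signed_permsD(2)[OF w y(1)] by auto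
    then have "w ?z = ?P * (sgn (w ?y) * \<bar>w ?y\<bar>)"
      using z(3) by (simp add: sgn_mult_abs)
    moreover have "w ?z \<in> signed n" "\<bar>w ?z\<bar> = \<bar>w ?y\<bar>"
      using signed_permsD(1,4)[OF w z(1)] z(2) by simp_all
    ultimately show ?case
      unfolding funpow.simps o_apply prod.lessThan_Suc mult.assoc by blast
  qed
  then show "(w ^^ j) i \<in> signed n" "\<bar>(w ^^ j) i\<bar> = (abs_perm w ^^ j) i"
    "(w ^^ j) i = (\<Prod>l<j. sgn (w ((abs_perm w ^^ l) i))) * (abs_perm w ^^ j) i"
    by blast+
qed

lemma funpow_bij_cycle:
  assumes w: "w \<in> signed_perms n" and C: "C \<in> cycles n w" and i: "i \<in> C"
  shows "bij_betw (\<lambda>j. (abs_perm w ^^ j) i) {..<card C} C" "(abs_perm w ^^ card C) i = i"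
proof -
  let ?d = "funpow_dist1 (abs_perm w) i i"
  have o: "orbit (abs_perm w) i = C" "i \<in> orbit (abs_perm w) i"
    using orbit_cycles(4)[OF w C i] i by auto
  have bij: "bij_betw (\<lambda>j. (abs_perm w ^^ j) i) {0..<?d} C"
    using orbit_conv_funpow_dist1[OF o(2)] inj_on_funpow_dist1[OF o(2)] o(1) by (simp add: bij_betw_def)
  then have d: "?d = card C"
    using bij_betw_same_card by fastforce
  show "bij_betw (\<lambda>j. (abs_perm w ^^ j) i) {..<card C} C"
    using bij unfolding d by (simp add: atLeast0LessThan)
  show "(abs_perm w ^^ card C) i = i"
    using funpow_dist1_prop[OF o(2)] unfolding d .
qed

text \<open>The iterates of \<open>i\<close> run once through \<open>C\<close>, and each \<open>y \<in> C\<close> with \<open>w y < 0\<close> contributes one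
  sign.\<close>

lemma funpow_card_cycle:
  assumes w: "w \<in> signed_perms n" and C: "C \<in> cycles n w" and i: "i \<in> C"
  shows "(w ^^ card C) i = (-1) ^ sign_reversals w C * i"
proof -
  have sub: "C \<subseteq> {1..int n}" and fin: "finite C"
    using orbit_cycles(3)[OF w C] cycles_finite_card[OF w C] by auto
  have nz: "w y \<noteq> 0" if "y \<in> C" for y
    using that signed_permsD(1)[OF w, of y] sub by (auto simp: signed_iff_abs)
  have "(w ^^ card C) i = (\<Prod>l<card C. sgn (w ((abs_perm w ^^ l) i))) * i"
    using funpow_signed_perm(3)[OF w, of i "card C"] funpow_bij_cycle(2)[OF assms] sub i by auto
  also have "(\<Prod>l<card C. sgn (w ((abs_perm w ^^ l) i))) = (\<Prod>y\<in>C. sgn (w y))"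
    by (rule prod.reindex_bij_betw[OF funpow_bij_cycle(1)[OF assms]])
  also have "\<dots> = (\<Prod>y\<in>C. if w y < 0 then - 1 else 1)"
    using nz by (intro prod.cong) (auto simp: sgn_if)
  also have "\<dots> = (-1) ^ sign_reversals w C"
    using fin by (simp add: prod.If_cases sign_reversals_def Collect_conj_eq)
  finally show ?thesis .
qed

text \<open>In the coordinates \<open>(j, s)\<close>, applying \<open>w\<close> increases \<open>j\<close>, except that at the end of the cycle
  \<open>j\<close> returns to 0 and \<open>s\<close> is multiplied by the sign of the cycle.\<close>

lemma signed_cycle_coordinates:
  assumes w: "w \<in> signed_perms n" and C: "C \<in> cycles n w" and i: "i \<in> C"
  shows "bij_betw (\<lambda>(j, s). s * (w ^^ j) i) ({..<card C} \<times> {1, - 1}) {x. \<bar>x\<bar> \<in> C}"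
proof -
  have sub: "C \<subseteq> {1..int n}"
    using orbit_cycles(3)[OF w C] .
  then have i': "i \<in> {1..int n}"
    using i by auto
  note bij = funpow_bij_cycle(1)[OF assms]
  note fp = funpow_signed_perm(1,2)[OF w i']
  have nz: "(w ^^ j) i \<noteq> 0" for j
    using fp(1)[of j] by (auto simp: signed_iff_abs)
  show ?thesis
    unfolding bij_betw_def
  proof
    show "inj_on (\<lambda>(j, s). s * (w ^^ j) i) ({..<card C} \<times> {1, - 1})"
    proof (rule inj_onI)
      fix a b assume ab: "a \<in> {..<card C} \<times> {1, - 1 :: int}" "b \<in> {..<card C} \<times> {1, - 1 :: int}"
        "(case a of (j, s) \<Rightarrow> s * (w ^^ j) i) = (case b of (j, s) \<Rightarrow> s * (w ^^ j) i)"
      obtain j s j' s' where p: "a = (j, s)" "b = (j', s')"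
        by (cases a, cases b)
      have *: "j \<in> {..<card C}" "j' \<in> {..<card C}" "s \<in> {1, - 1}" "s' \<in> {1, - 1}"
        "s * (w ^^ j) i = s' * (w ^^ j') i"
        using ab by (simp_all add: p)
      then have "\<bar>s * (w ^^ j) i\<bar> = \<bar>s' * (w ^^ j') i\<bar>"
        by simp
      with *(3,4) have "(abs_perm w ^^ j) i = (abs_perm w ^^ j') i"
        using fp(2)[of j] fp(2)[of j'] by (auto simp: abs_mult)
      then have "j = j'"
        using bij *(1,2) by (auto simp: bij_betw_def inj_on_def)
      with *(5) nz[of j] show "a = b"
        by (simp add: p)
    qed
    show "(\<lambda>(j, s). s * (w ^^ j) i) ` ({..<card C} \<times> {1, - 1}) = {x. \<bar>x\<bar> \<in> C}"
    proof (intro equalityI subsetI)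
      fix x assume "x \<in> (\<lambda>(j, s). s * (w ^^ j) i) ` ({..<card C} \<times> {1, - 1})"
      then show "x \<in> {x. \<bar>x\<bar> \<in> C}"
        using bij fp(2) by (auto simp: bij_betw_def)
    next
      fix x assume "x \<in> {x. \<bar>x\<bar> \<in> C}"
      then have "\<bar>x\<bar> \<in> (\<lambda>j. (abs_perm w ^^ j) i) ` {..<card C}"
        using bij by (simp add: bij_betw_def)
      then obtain j where j: "j < card C" "\<bar>x\<bar> = \<bar>(w ^^ j) i\<bar>"
        using fp(2) by auto
      from j(2) consider "x = 1 * (w ^^ j) i" | "x = - 1 * (w ^^ j) i"
        by (auto simp: abs_eq_iff)
      then show "x \<in> (\<lambda>(j, s). s * (w ^^ j) i) ` ({..<card C} \<times> {1, - 1})"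
        using j(1) by cases (auto intro: rev_image_eqI[of "(j, 1)"] rev_image_eqI[of "(j, - 1)"])
    qed
  qed
qed

text \<open>Matching the coordinates of the two cycles commutes with the action, also where the coordinate
  \<open>j\<close> wraps around, since both cycles have the same length and the same sign.\<close>

lemma cycle_type_isomorphism:
  assumes w: "w \<in> signed_perms n" "C \<in> cycles n w"
    and w': "w' \<in> signed_perms n'" "C' \<in> cycles n' w'"
    and type: "cycle_type w C = cycle_type w' C'"
  shows "\<exists>h. bij_betw h {x. \<bar>x\<bar> \<in> C} {x. \<bar>x\<bar> \<in> C'} \<and>
    (\<forall>x. \<bar>x\<bar> \<in> C \<longrightarrow> h (- x) = - h x \<and> h (w x) = w' (h x))"
proof -
  obtain i i' where i: "i \<in> C" "i' \<in> C'"
    using cycles_finite_card(2)[OF w] cycles_finite_card(2)[OF w'] by blast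
  let ?r = "card C" and ?J = "{..<card C} \<times> {1, - 1 :: int}"
  have r: "card C' = ?r" and par: "even (sign_reversals w C) \<longleftrightarrow> even (sign_reversals w' C')"
    using type by (auto simp: cycle_type_def split: if_splits)
  define \<epsilon> :: int where "\<epsilon> = (-1) ^ sign_reversals w C"
  have \<epsilon>: "\<epsilon> \<in> {1, - 1}" "(w ^^ ?r) i = \<epsilon> * i" "(w' ^^ ?r) i' = \<epsilon> * i'"
    using funpow_card_cycle[OF w i(1)] funpow_card_cycle[OF w' i(2)] par
    by (auto simp: \<epsilon>_def r minus_one_power_iff)
  define f where "f = (\<lambda>(j, s). s * (w ^^ j) i)"
  define f' where "f' = (\<lambda>(j, s). s * (w' ^^ j) i')"
  have f: "bij_betw f ?J {x. \<bar>x\<bar> \<in> C}" and f': "bij_betw f' ?J {x. \<bar>x\<bar> \<in> C'}"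
    using signed_cycle_coordinates[OF w i(1)] signed_cycle_coordinates[OF w' i(2)]
    by (simp_all add: f_def f'_def r)
  define h where "h = f' \<circ> inv_into ?J f"
  have bij: "bij_betw h {x. \<bar>x\<bar> \<in> C} {x. \<bar>x\<bar> \<in> C'}"
    unfolding h_def by (rule bij_betw_trans[OF bij_betw_inv_into[OF f] f'])
  have h: "h (f p) = f' p" if "p \<in> ?J" for p
    using that bij_betw_inv_into_left[OF f] by (simp add: h_def)
  have sgn: "w (s * x) = s * w x" if "w \<in> signed_perms n" "x \<in> signed n" "s \<in> {1, - 1}" for w n s x
    using that signed_permsD(2) by auto
  have step: "\<exists>q\<in>?J. w (s * (w ^^ j) i) = (case q of (j, s) \<Rightarrow> s * (w ^^ j) i) \<and>
      w' (s * (w' ^^ j) i') = (case q of (j, s) \<Rightarrow> s * (w' ^^ j) i')"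
    if "(j, s) \<in> ?J" for j s
  proof -
    have "i \<in> {1..int n}" "i' \<in> {1..int n'}"
      using i orbit_cycles(3)[OF w] orbit_cycles(3)[OF w'] by auto
    then have eqs: "w (s * (w ^^ j) i) = s * (w ^^ Suc j) i" "w' (s * (w' ^^ j) i') = s * (w' ^^ Suc j) i'"
      using that sgn[OF w(1) funpow_signed_perm(1)[OF w(1)]] sgn[OF w'(1) funpow_signed_perm(1)[OF w'(1)]]
      by auto
    have "\<exists>q\<in>?J. s * (w ^^ Suc j) i = (case q of (j, s) \<Rightarrow> s * (w ^^ j) i) \<and>
        s * (w' ^^ Suc j) i' = (case q of (j, s) \<Rightarrow> s * (w' ^^ j) i')"
    proof (cases "Suc j = ?r")
      case True
      have "(0, s * \<epsilon>) \<in> ?J"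
        using that \<epsilon>(1) by auto
      then show ?thesis
        using \<epsilon>(2,3) unfolding True by (intro bexI[of _ "(0, s * \<epsilon>)"]) auto
    next
      case False
      then have "(Suc j, s) \<in> ?J"
        using that by auto
      then show ?thesis
        by (intro bexI[of _ "(Suc j, s)"]) auto
    qed
    then show ?thesis
      unfolding eqs .
  qed
  have "h (- x) = - h x \<and> h (w x) = w' (h x)" if x: "\<bar>x\<bar> \<in> C" for x
  proof -
    have "x \<in> f ` ?J"
      using x bij_betw_imp_surj_on[OF f] by simp
    then obtain j s where p: "(j, s) \<in> ?J" "x = f (j, s)"
      by (elim imageE) (metis surj_pair)
    have "(j, - s) \<in> ?J" "f (j, - s) = - x" "f' (j, - s) = - f' (j, s)"
      using p by (auto simp: f_def f'_def)
    then have "h (- x) = - h x"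
      using h[of "(j, - s)"] h[of "(j, s)"] p by simp
    moreover have "\<exists>q\<in>?J. w (f (j, s)) = f q \<and> w' (f' (j, s)) = f' q"
      using step[OF p(1)] unfolding f_def f'_def prod.case .
    then obtain q where q: "q \<in> ?J" "w (f (j, s)) = f q" "w' (f' (j, s)) = f' q"
      by blast
    have "h (w x) = w' (h x)"
      using h[OF q(1)] h[OF p(1)] q(2,3) p(2) by simp
    ultimately show ?thesis ..
  qed
  with bij show ?thesis by blast
qed

text \<open>A bijection can be chosen on each fibre separately.\<close>

lemma exists_fibre_bijection:
  assumes "finite A" "finite B"
    and "\<And>x. card {a \<in> A. f a = x} = card {b \<in> B. g b = x}"
  shows "\<exists>\<beta>. bij_betw \<beta> A B \<and> (\<forall>a\<in>A. g (\<beta> a) = f a)"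
proof -
  have "\<exists>b. bij_betw b {a \<in> A. f a = x} {b \<in> B. g b = x}" for x
    using assms by (intro finite_same_card_bij) auto
  then obtain b where b: "\<And>x. bij_betw (b x) {a \<in> A. f a = x} {b \<in> B. g b = x}"
    by metis
  define \<beta> where "\<beta> a = b (f a) a" for a
  have \<beta>: "\<beta> a \<in> B" "g (\<beta> a) = f a" if "a \<in> A" for a
    using bij_betwE[OF b[of "f a"]] that by (auto simp: \<beta>_def)
  have "bij_betw \<beta> A B"
  proof (rule bij_betwI')
    show "\<beta> a = \<beta> a' \<longleftrightarrow> a = a'" if "a \<in> A" "a' \<in> A" for a a'
    proof
      assume eq: "\<beta> a = \<beta> a'"
      then have "f a = f a'"
        using \<beta>(2) that by metis
      then show "a = a'"
        using eq that inj_onD[OF bij_betw_imp_inj_on[OF b[of "f a"]], of a a'] by (simp add: \<beta>_def)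
    qed simp
    show "\<exists>a\<in>A. y = \<beta> a" if "y \<in> B" for y
    proof -
      have "y \<in> b (g y) ` {a \<in> A. f a = g y}"
        using bij_betw_imp_surj_on[OF b[of "g y"]] that by simp
      then obtain a where "a \<in> A" "f a = g y" "y = b (g y) a"
        by auto
      then show ?thesis
        unfolding \<beta>_def by (metis (no_types))
    qed
  qed (use \<beta> in auto)
  with \<beta> show ?thesis by blast
qed

text \<open>A type-preserving bijection between two sets of cycles, together with an isomorphism for each
  pair of matched cycles, gives an isomorphism on the unions.\<close>

lemma type_count_isomorphism:
  assumes w: "w \<in> signed_perms n" "D \<subseteq> cycles n w"
    and w': "w' \<in> signed_perms n'" "D' \<subseteq> cycles n' w'"
    and count: "\<And>x. type_count w D x = type_count w' D' x"
  shows "\<exists>h. bij_betw h {x. \<bar>x\<bar> \<in> \<Union>D} {x. \<bar>x\<bar> \<in> \<Union>D'} \<and>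
    (\<forall>x. \<bar>x\<bar> \<in> \<Union>D \<longrightarrow> h (- x) = - h x \<and> h (w x) = w' (h x))"
proof -
  have "finite D" "finite D'"
    using w(2) w'(2) by (auto intro: finite_subset[OF _ finite_cycles])
  then obtain \<beta> where \<beta>: "bij_betw \<beta> D D'" "\<And>C. C \<in> D \<Longrightarrow> cycle_type w' (\<beta> C) = cycle_type w C"
    using exists_fibre_bijection[of D D' "cycle_type w" "cycle_type w'"] count
    unfolding type_count_def by blast
  have \<beta>_in: "\<beta> C \<in> D'" if "C \<in> D" for C
    using \<beta>(1) that by (auto simp: bij_betw_def)
  have "\<exists>h. bij_betw h {x. \<bar>x\<bar> \<in> C} {x. \<bar>x\<bar> \<in> \<beta> C} \<and>
      (\<forall>x. \<bar>x\<bar> \<in> C \<longrightarrow> h (- x) = - h x \<and> h (w x) = w' (h x))" if "C \<in> D" for C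
    using that \<beta>(2)[OF that] \<beta>_in[OF that] w w'
    by (intro cycle_type_isomorphism[of w n C w' n']) auto
  then obtain H where H: "\<And>C. C \<in> D \<Longrightarrow> bij_betw (H C) {x. \<bar>x\<bar> \<in> C} {x. \<bar>x\<bar> \<in> \<beta> C}"
    "\<And>C x. C \<in> D \<Longrightarrow> \<bar>x\<bar> \<in> C \<Longrightarrow> H C (- x) = - H C x \<and> H C (w x) = w' (H C x)"
    by metis
  define h where "h x = H (orbit (abs_perm w) \<bar>x\<bar>) x" for x
  have h: "h x = H C x" if "C \<in> D" "\<bar>x\<bar> \<in> C" for C x
    using orbit_cycles(4)[OF w(1), of C "\<bar>x\<bar>"] that w(2) by (auto simp: h_def)
  have h_in: "\<bar>h x\<bar> \<in> \<beta> C" if "C \<in> D" "\<bar>x\<bar> \<in> C" for C x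
    using h[OF that] bij_betwE[OF H(1)[OF that(1)]] that(2) by auto
  have "bij_betw h {x. \<bar>x\<bar> \<in> \<Union>D} {x. \<bar>x\<bar> \<in> \<Union>D'}"
  proof (rule bij_betwI')
    fix x assume "x \<in> {x. \<bar>x\<bar> \<in> \<Union>D}"
    then obtain C where C: "C \<in> D" "\<bar>x\<bar> \<in> C"
      by auto
    then show "h x \<in> {x. \<bar>x\<bar> \<in> \<Union>D'}"
      using h_in[OF C] \<beta>_in[OF C(1)] by auto
    fix y assume "y \<in> {x. \<bar>x\<bar> \<in> \<Union>D}"
    then obtain C' where C': "C' \<in> D" "\<bar>y\<bar> \<in> C'"
      by auto
    show "h x = h y \<longleftrightarrow> x = y"
    proof
      assume eq: "h x = h y"
      have "\<beta> C = \<beta> C'"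
        using cycles_disjoint[OF w'(1), of "\<beta> C" "\<beta> C'" "\<bar>h x\<bar>"] h_in[OF C] h_in[OF C'] eq
          \<beta>_in[OF C(1)] \<beta>_in[OF C'(1)] w'(2) by auto
      then have "C = C'"
        using inj_onD[OF bij_betw_imp_inj_on[OF \<beta>(1)]] C(1) C'(1) by blast
      then show "x = y"
        using inj_onD[OF bij_betw_imp_inj_on[OF H(1)[OF C(1)]], of x y] eq h[OF C] h[OF C'] C(2) C'(2)
        by simp
    qed simp
  next
    fix y assume "y \<in> {x. \<bar>x\<bar> \<in> \<Union>D'}"
    then obtain C' where "C' \<in> D'" "\<bar>y\<bar> \<in> C'"
      by auto
    then obtain C where C: "C \<in> D" "\<bar>y\<bar> \<in> \<beta> C"
      using bij_betw_imp_surj_on[OF \<beta>(1)] by blast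
    then have "y \<in> H C ` {x. \<bar>x\<bar> \<in> C}"
      using bij_betw_imp_surj_on[OF H(1)[OF C(1)]] by simp
    then obtain x where "\<bar>x\<bar> \<in> C" "y = H C x"
      by auto
    then show "\<exists>x\<in>{x. \<bar>x\<bar> \<in> \<Union>D}. y = h x"
      using h[OF C(1), of x] C(1) by auto
  qed
  moreover have "h (- x) = - h x \<and> h (w x) = w' (h x)" if x: "\<bar>x\<bar> \<in> \<Union>D" for x
  proof -
    obtain C where C: "C \<in> D" "\<bar>x\<bar> \<in> C"
      using x by auto
    have "C \<in> cycles n w"
      using C(1) w(2) by auto
    then have "x \<in> signed n"
      using C(2) orbit_cycles(3)[OF w(1), of C] unfolding signed_iff_abs by blast
    then have "\<bar>w x\<bar> \<in> C"
      using Union_cycles_stable[OF w(1), of "{C}"] C(2) \<open>C \<in> cycles n w\<close> by simp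
    then show ?thesis
      using h[OF C(1), of x] h[OF C(1), of "- x"] h[OF C(1), of "w x"] C(2) H(2)[OF C] by simp
  qed
  ultimately show ?thesis
    by blast
qed

context trace_function
begin

lemma local_trace_eqI:
  assumes w: "w \<in> signed_perms n" "D \<subseteq> cycles n w"
    and w': "w' \<in> signed_perms n'" "D' \<subseteq> cycles n' w'"
    and count: "\<And>x. type_count w D x = type_count w' D' x"
  shows "local_trace n w (\<Union>D) = local_trace n' w' (\<Union>D')"
proof -
  obtain h where h: "bij_betw h {x. \<bar>x\<bar> \<in> \<Union>D} {x. \<bar>x\<bar> \<in> \<Union>D'}"
    "\<And>x. \<bar>x\<bar> \<in> \<Union>D \<Longrightarrow> h (- x) = - h x" "\<And>x. \<bar>x\<bar> \<in> \<Union>D \<Longrightarrow> h (w x) = w' (h x)"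
    using type_count_isomorphism[OF assms] by blast
  have "\<Union>D \<subseteq> {1..int n}" "\<Union>D' \<subseteq> {1..int n'}"
    using orbit_cycles(3)[OF w(1)] orbit_cycles(3)[OF w'(1)] w(2) w'(2) by (blast, blast)
  then show ?thesis
    by (intro local_trace_conjugate[OF w(1) w'(1) _ _ h(1)] h(2,3)
        Union_cycles_stable[OF w] Union_cycles_stable[OF w']) auto
qed

text \<open>Only the stable sets contribute to the trace, and these are the unions of cycles.\<close>

lemma trace_eq_sum_cycles:
  assumes w: "w \<in> signed_perms n"
  shows "\<theta> n (extend0 n w) =
    (\<Sum>D\<in>Pow (cycles n w). (-1) ^ card (\<Union>D) * local_trace n w (\<Union>D))"
proof -
  have "\<theta> n (extend0 n w) = (\<Sum>S\<in>Pow {1..int n}. (-1) ^ card S * local_trace n w S)"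
    by (rule trace_eq_sum_local_trace[OF w])
  also have "\<dots> = (\<Sum>S\<in>Union ` Pow (cycles n w). (-1) ^ card S * local_trace n w S)"
  proof (rule sum.mono_neutral_right)
    show "Union ` Pow (cycles n w) \<subseteq> Pow {1..int n}"
      using orbit_cycles(3)[OF w] by blast
    have "local_trace n w S = 0" if S: "S \<subseteq> {1..int n}" "S \<notin> Union ` Pow (cycles n w)" for S
    proof -
      have "\<not> S \<subseteq> abs_perm w ` S"
        using stable_eq_Union_cycles[OF w S(1)] S(2) by blast
      then obtain i where "i \<in> S" "i \<notin> abs_perm w ` S"
        by auto
      moreover have "finite S"
        using S(1) finite_subset by auto
      ultimately show ?thesis
        using local_trace_unstable[OF w] by blast
    qed
    then show "\<forall>S\<in>Pow {1..int n} - Union ` Pow (cycles n w). (-1) ^ card S * local_trace n w S = 0"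
      by simp
  qed simp
  also have "\<dots> = (\<Sum>D\<in>Pow (cycles n w). (-1) ^ card (\<Union>D) * local_trace n w (\<Union>D))"
    by (simp add: sum.reindex[OF inj_on_Union_cycles[OF w]])
  finally show ?thesis .
qed

end

section \<open>Polynomials in the cycle counts\<close>

definition monom_eval :: "(cvar \<Rightarrow>\<^sub>0 nat) \<Rightarrow> (cvar \<Rightarrow> 'k::field) \<Rightarrow> 'k" where
  "monom_eval m \<phi> = (\<Prod>x\<in>Poly_Mapping.keys m. \<phi> x ^ Poly_Mapping.lookup m x)"

lemma monom_eval_superset:
  assumes "finite A" "Poly_Mapping.keys m \<subseteq> A"
  shows "monom_eval m \<phi> = (\<Prod>x\<in>A. \<phi> x ^ Poly_Mapping.lookup m x)"
  unfolding monom_eval_def using assms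
  by (intro prod.mono_neutral_left) (auto simp: in_keys_iff)

lemma monom_deg_superset:
  assumes "finite A" "Poly_Mapping.keys m \<subseteq> A"
  shows "monom_deg m = (\<Sum>x\<in>A. Poly_Mapping.lookup m x * cvar_index x)"
  unfolding monom_deg_def using assms
  by (intro sum.mono_neutral_left) (auto simp: in_keys_iff)

lemma monom_add_single:
  "monom_eval (m + Poly_Mapping.single x 1) \<phi> = \<phi> x * monom_eval m \<phi>"
  "monom_deg (m + Poly_Mapping.single x 1) = monom_deg m + cvar_index x"
proof -
  let ?A = "insert x (Poly_Mapping.keys m)" and ?m = "m + Poly_Mapping.single x 1"
  have keys: "Poly_Mapping.keys ?m \<subseteq> ?A"
    using keys_add[of m "Poly_Mapping.single x 1"] by auto
  have look: "Poly_Mapping.lookup ?m y = Poly_Mapping.lookup m y + (if y = x then 1 else 0)" for y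
    by (auto simp: lookup_add lookup_single)
  have "monom_eval ?m \<phi> = (\<Prod>y\<in>?A. \<phi> y ^ Poly_Mapping.lookup m y * (if y = x then \<phi> x else 1))"
    using keys by (auto simp: monom_eval_superset[of ?A] look power_add intro!: prod.cong
        simp del: One_nat_def)
  also have "\<dots> = monom_eval m \<phi> * \<phi> x"
    by (subst monom_eval_superset[of ?A]) (auto simp: prod.distrib)
  finally show "monom_eval ?m \<phi> = \<phi> x * monom_eval m \<phi>"
    by (simp add: mult.commute)
  have "monom_deg ?m = (\<Sum>y\<in>?A. Poly_Mapping.lookup m y * cvar_index y + (if y = x then cvar_index x else 0))"
    using keys by (auto simp: monom_deg_superset[of ?A] look add_mult_distrib intro!: sum.cong
        simp del: One_nat_def)
  also have "\<dots> = monom_deg m + cvar_index x"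
    by (subst monom_deg_superset[of ?A]) (auto simp: sum.distrib)
  finally show "monom_deg ?m = monom_deg m + cvar_index x" .
qed

lemma eval_cpoly_superset:
  assumes "finite A" "Poly_Mapping.keys F \<subseteq> A"
  shows "eval_cpoly F \<phi> = (\<Sum>m\<in>A. Poly_Mapping.lookup F m * monom_eval m \<phi>)"
  unfolding eval_cpoly_def monom_eval_def[symmetric] using assms
  by (intro sum.mono_neutral_left) (auto simp: in_keys_iff)

lemma eval_cpoly_add: "eval_cpoly (F + G) \<phi> = eval_cpoly F \<phi> + eval_cpoly G \<phi>"
  using keys_add[of F G]
  by (simp add: eval_cpoly_superset[of "Poly_Mapping.keys F \<union> Poly_Mapping.keys G"] lookup_add
      algebra_simps sum.distrib)

lemma cpoly_deg_le_iff: "cpoly_deg F \<le> e \<longleftrightarrow> (\<forall>m\<in>Poly_Mapping.keys F. monom_deg m \<le> e)"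
  by (simp add: cpoly_deg_def)

text \<open>Representability by a character polynomial of bounded degree is a property of functions, so that
  products need not be formed in the ring of polynomials.\<close>

definition cpoly_representable :: "nat \<Rightarrow> ((cvar \<Rightarrow> 'k::field) \<Rightarrow> 'k) \<Rightarrow> bool" where
  "cpoly_representable e g \<longleftrightarrow>
    (\<exists>F\<in>character_polys. cpoly_deg F \<le> e \<and> (\<forall>\<phi>. eval_cpoly F \<phi> = g \<phi>))"

lemma cpoly_representable_mono:
  assumes "cpoly_representable e g" "e \<le> e'"
  shows "cpoly_representable e' g"
  using assms by (auto simp: cpoly_representable_def intro: order_trans)


lemma cpoly_representable_monom:
  assumes "\<And>x. x \<in> Poly_Mapping.keys m \<Longrightarrow> 1 \<le> cvar_index x" "monom_deg m \<le> e"
  shows "cpoly_representable e (\<lambda>\<phi>. c * monom_eval m \<phi>)"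
  unfolding cpoly_representable_def
proof (intro bexI[of _ "Poly_Mapping.single m c"] conjI allI)
  have "Poly_Mapping.keys (Poly_Mapping.single m c) \<subseteq> {m}"
    by simp
  then show "Poly_Mapping.single m c \<in> character_polys" "cpoly_deg (Poly_Mapping.single m c) \<le> e"
    using assms by (auto simp: character_polys_def cpoly_deg_le_iff)
  show "eval_cpoly (Poly_Mapping.single m c) \<phi> = c * monom_eval m \<phi>" for \<phi>
    by (subst eval_cpoly_superset[of "{m}"]) auto
qed

lemma cpoly_representable_const: "cpoly_representable e (\<lambda>\<phi>. c)"
  using cpoly_representable_monom[of 0 e c] by (simp add: monom_eval_def monom_deg_def)

lemma cpoly_representable_add:
  assumes "cpoly_representable e f" "cpoly_representable e g"
  shows "cpoly_representable e (\<lambda>\<phi>. f \<phi> + g \<phi>)"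
proof -
  obtain F G where FG: "F \<in> character_polys" "G \<in> character_polys" "cpoly_deg F \<le> e" "cpoly_deg G \<le> e"
    "\<And>\<phi>. eval_cpoly F \<phi> = f \<phi>" "\<And>\<phi>. eval_cpoly G \<phi> = g \<phi>"
    using assms by (auto simp: cpoly_representable_def)
  moreover have "F + G \<in> character_polys" "cpoly_deg (F + G) \<le> e"
    using FG(1-4) keys_add[of F G] unfolding character_polys_def cpoly_deg_le_iff by blast+
  ultimately show ?thesis
    unfolding cpoly_representable_def by (metis eval_cpoly_add)
qed

lemma cpoly_representable_sum:
  assumes "\<And>i. i \<in> I \<Longrightarrow> cpoly_representable e (f i)"
  shows "cpoly_representable e (\<lambda>\<phi>. \<Sum>i\<in>I. f i \<phi>)"
  using assms
  by (induction I rule: infinite_finite_induct)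
    (auto intro: cpoly_representable_const cpoly_representable_add)

lemma cpoly_representable_cmult:
  assumes "cpoly_representable e f"
  shows "cpoly_representable e (\<lambda>\<phi>. c * f \<phi>)"
proof -
  obtain F where F: "F \<in> character_polys" "cpoly_deg F \<le> e" "\<And>\<phi>. eval_cpoly F \<phi> = f \<phi>"
    using assms by (auto simp: cpoly_representable_def)
  have "c * f \<phi> = (\<Sum>m\<in>Poly_Mapping.keys F. (c * Poly_Mapping.lookup F m) * monom_eval m \<phi>)" for \<phi>
    by (simp add: eval_cpoly_superset[OF _ order_refl] sum_distrib_left mult.assoc flip: F(3))
  moreover have "cpoly_representable e
      (\<lambda>\<phi>. \<Sum>m\<in>Poly_Mapping.keys F. (c * Poly_Mapping.lookup F m) * monom_eval m \<phi>)"
    using F(1,2)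
    by (intro cpoly_representable_sum cpoly_representable_monom)
      (auto simp: character_polys_def cpoly_deg_le_iff)
  ultimately show ?thesis
    by simp
qed

lemma cpoly_representable_var:
  assumes "cpoly_representable e f" "1 \<le> cvar_index x"
  shows "cpoly_representable (e + cvar_index x) (\<lambda>\<phi>. \<phi> x * f \<phi>)"
proof -
  obtain F where F: "F \<in> character_polys" "cpoly_deg F \<le> e" "\<And>\<phi>. eval_cpoly F \<phi> = f \<phi>"
    using assms by (auto simp: cpoly_representable_def)
  let ?s = "\<lambda>m. m + Poly_Mapping.single x (1::nat)"
  have "\<phi> x * f \<phi> = (\<Sum>m\<in>Poly_Mapping.keys F. Poly_Mapping.lookup F m * monom_eval (?s m) \<phi>)" for \<phi>
    by (simp only: eval_cpoly_superset[OF _ order_refl] sum_distrib_left monom_add_single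
        mult.left_commute finite_keys flip: F(3))
  moreover have "cpoly_representable (e + cvar_index x)
      (\<lambda>\<phi>. \<Sum>m\<in>Poly_Mapping.keys F. Poly_Mapping.lookup F m * monom_eval (?s m) \<phi>)"
  proof (intro cpoly_representable_sum cpoly_representable_monom)
    fix m assume m: "m \<in> Poly_Mapping.keys F"
    then show "monom_deg (?s m) \<le> e + cvar_index x"
      using F(2) by (simp add: monom_add_single(2) cpoly_deg_le_iff del: One_nat_def)
    show "1 \<le> cvar_index y" if "y \<in> Poly_Mapping.keys (?s m)" for y
      using that m F(1) assms(2) keys_add[of m "Poly_Mapping.single x 1"]
      by (auto simp: character_polys_def)
  qed
  ultimately show ?thesis
    by simp
qed

lemma cpoly_representable_gbinomial:
  fixes f :: "(cvar \<Rightarrow> 'k::field_char_0) \<Rightarrow> 'k"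
  assumes "cpoly_representable e f" "1 \<le> cvar_index x"
  shows "cpoly_representable (e + k * cvar_index x) (\<lambda>\<phi>. (\<phi> x gchoose k) * f \<phi>)"
proof -
  have "cpoly_representable (e + k * cvar_index x) (\<lambda>\<phi>. (\<Prod>i=0..<k. \<phi> x - of_nat i) * f \<phi>)"
  proof (induction k)
    case 0
    then show ?case
      using assms(1) by simp
  next
    case (Suc k)
    let ?g = "\<lambda>\<phi>. (\<Prod>i=0..<k. \<phi> x - of_nat i) * f \<phi>"
    have "cpoly_representable (e + k * cvar_index x + cvar_index x)
        (\<lambda>\<phi>. \<phi> x * ?g \<phi> + (- of_nat k) * ?g \<phi>)"
      using Suc by (intro cpoly_representable_add cpoly_representable_var
          cpoly_representable_mono[OF cpoly_representable_cmult] assms(2)) auto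
    then show ?case
      by (simp add: algebra_simps)
  qed
  then have "cpoly_representable (e + k * cvar_index x)
      (\<lambda>\<phi>. inverse (fact k) * ((\<Prod>i=0..<k. \<phi> x - of_nat i) * f \<phi>))"
    by (rule cpoly_representable_cmult)
  then show ?thesis
    by (simp add: gbinomial_prod_rev field_simps)
qed

lemma cpoly_representable_prod_gbinomial:
  assumes "finite X" "\<And>x. x \<in> X \<Longrightarrow> 1 \<le> cvar_index x"
  shows "cpoly_representable (\<Sum>x\<in>X. \<tau> x * cvar_index x)
    (\<lambda>\<phi>. \<Prod>x\<in>X. (\<phi> x :: 'k::field_char_0) gchoose \<tau> x)"
  using assms
proof (induction X)
  case empty
  then show ?case
    by (simp add: cpoly_representable_const)
next
  case (insert x X)
  then show ?case
    using cpoly_representable_gbinomial[of "\<Sum>x\<in>X. \<tau> x * cvar_index x" _ x "\<tau> x"]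
    by (simp add: add.commute)
qed

section \<open>Counting sets of cycles of a given type\<close>

text \<open>Such a subset is an independent choice of a subset of the given size in each fibre.\<close>

lemma card_subsets_with_fibre_cards:
  assumes "finite A" "finite X"
  shows "card {D. D \<subseteq> A \<and> f ` D \<subseteq> X \<and> (\<forall>x\<in>X. card {a \<in> D. f a = x} = \<tau> x)} =
    (\<Prod>x\<in>X. card {a \<in> A. f a = x} choose \<tau> x)" (is "card ?L = _")
proof -
  let ?P = "\<Pi>\<^sub>E x\<in>X. {B. B \<subseteq> {a \<in> A. f a = x} \<and> card B = \<tau> x}"
  have "bij_betw (\<lambda>D. \<lambda>x\<in>X. {a \<in> D. f a = x}) ?L ?P"
  proof (rule bij_betw_byWitness[where f' = "\<lambda>g. \<Union>x\<in>X. g x"])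
    show "\<forall>D\<in>?L. (\<Union>x\<in>X. (\<lambda>x\<in>X. {a \<in> D. f a = x}) x) = D"
      by auto
    have fib: "{a \<in> \<Union>x\<in>X. g x. f a = y} = g y" if g: "g \<in> ?P" and y: "y \<in> X" for g y
    proof -
      have "g x \<subseteq> {a \<in> A. f a = x}" if "x \<in> X" for x
        using PiE_mem[OF g that] by blast
      with y show ?thesis by blast
    qed
    show "\<forall>g\<in>?P. (\<lambda>x\<in>X. {a \<in> \<Union>x\<in>X. g x. f a = x}) = g"
    proof
      fix g assume g: "g \<in> ?P"
      show "(\<lambda>x\<in>X. {a \<in> \<Union>x\<in>X. g x. f a = x}) = g"
      proof
        fix y
        show "(\<lambda>x\<in>X. {a \<in> \<Union>x\<in>X. g x. f a = x}) y = g y"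
          using fib[OF g, of y] PiE_arb[OF g, of y] by (cases "y \<in> X") simp_all
      qed
    qed
    show "(\<lambda>D. \<lambda>x\<in>X. {a \<in> D. f a = x}) ` ?L \<subseteq> ?P"
      by auto
    show "(\<lambda>g. \<Union>x\<in>X. g x) ` ?P \<subseteq> ?L"
    proof
      fix D assume "D \<in> (\<lambda>g. \<Union>x\<in>X. g x) ` ?P"
      then obtain g where g: "g \<in> ?P" "D = (\<Union>x\<in>X. g x)"
        by blast
      have "g x \<subseteq> {a \<in> A. f a = x}" "card (g x) = \<tau> x" if "x \<in> X" for x
        using PiE_mem[OF g(1) that] by blast+
      then show "D \<in> ?L"
        using fib[OF g(1)] g(2) by auto
    qed
  qed
  then have "card ?L = card ?P"
    by (rule bij_betw_same_card)
  also have "\<dots> = (\<Prod>x\<in>X. card {a \<in> A. f a = x} choose \<tau> x)"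
    using assms by (subst card_PiE) (auto simp: n_subsets intro!: prod.cong)
  finally show ?thesis .
qed

section \<open>Character polynomials are determined by their values on cycle counts\<close>

text \<open>By linearity the hypothesis extends from powers to all polynomials, and a Lagrange polynomial
  isolates one coefficient.\<close>

lemma power_sums_eq_0_imp_coeffs_eq_0:
  fixes c y :: "'a \<Rightarrow> 'k::field"
  assumes "finite A" "inj_on y A" and 0: "\<And>j. (\<Sum>m\<in>A. c m * y m ^ j) = 0" and "m \<in> A"
  shows "c m = 0"
proof -
  have poly: "(\<Sum>m\<in>A. c m * poly q (y m)) = 0" for q
  proof -
    have "(\<Sum>m\<in>A. c m * poly q (y m)) = (\<Sum>j\<le>degree q. coeff q j * (\<Sum>m\<in>A. c m * y m ^ j))"
      by (simp add: poly_altdef sum_distrib_left mult_ac) (rule sum.swap)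
    then show ?thesis
      by (simp add: 0)
  qed
  define q where "q = (\<Prod>m'\<in>A - {m}. [:- y m', 1:])"
  have "poly q (y m') = 0" if "m' \<in> A - {m}" for m'
    using that assms(1) by (force simp: q_def poly_prod)
  then have "(\<Sum>m\<in>A. c m * poly q (y m)) = c m * poly q (y m)"
    using assms(1,4) by (simp add: sum.remove[of A m])
  then have "c m * poly q (y m) = 0"
    using poly by simp
  moreover have "poly q (y m) \<noteq> 0"
    using assms(1,2,4) by (auto simp: q_def poly_prod inj_on_def)
  ultimately show ?thesis
    by simp
qed

lemma prime_power_products_inj:
  fixes p :: "'a \<Rightarrow> nat"
  assumes "finite K" "inj_on p K" "\<And>x. x \<in> K \<Longrightarrow> prime (p x)"
    and eq: "(\<Prod>x\<in>K. p x ^ e x) = (\<Prod>x\<in>K. p x ^ e' x)" and "x \<in> K"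
  shows "e x = e' x"
proof -
  have "multiplicity (p x) (\<Prod>x\<in>K. p x ^ e x) = e x" for e
  proof -
    have "(\<Prod>x\<in>K. p x ^ e x) = (\<Prod>q\<in>p ` K. q ^ e (inv_into K p q))"
      using assms(2) by (simp add: prod.reindex)
    also have "multiplicity (p x) \<dots> = e x"
      using assms by (subst multiplicity_prod_prime_powers) auto
    finally show ?thesis .
  qed
  with eq show ?thesis by metis
qed

text \<open>Substituting the \<open>j\<close>th powers of distinct primes for the variables turns each monomial into the
  \<open>j\<close>th power of a natural number that determines the monomial, by unique factorization. The
  coefficients are then determined by a Vandermonde argument.\<close>

lemma cpoly_eqI:
  fixes F G :: "'k::field_char_0 cpoly"
  assumes FG: "F \<in> character_polys" "G \<in> character_polys"
    and eq: "\<And>\<kappa> :: cvar \<Rightarrow> nat. finite {x. \<kappa> x \<noteq> 0} \<Longrightarrow> (\<And>x. \<kappa> x \<noteq> 0 \<Longrightarrow> 1 \<le> cvar_index x) \<Longrightarrow>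
      eval_cpoly F (\<lambda>x. of_nat (\<kappa> x)) = eval_cpoly G (\<lambda>x. of_nat (\<kappa> x))"
  shows "F = G"
proof -
  define A where "A = Poly_Mapping.keys F \<union> Poly_Mapping.keys G"
  define K where "K = (\<Union>m\<in>A. Poly_Mapping.keys m)"
  have "finite A" "finite K"
    by (auto simp: A_def K_def)
  have K_index: "1 \<le> cvar_index x" if "x \<in> K" for x
    using that FG by (auto simp: K_def A_def character_polys_def)
  obtain Q where Q: "finite Q" "card Q = card K" "Q \<subseteq> {q::nat. prime q}"
    using infinite_arbitrarily_large[OF primes_infinite] by blast
  obtain p where p: "bij_betw p K Q"
    using finite_same_card_bij[OF \<open>finite K\<close> Q(1)] Q(2) by auto
  have p_inj: "inj_on p K" and p_prime: "\<And>x. x \<in> K \<Longrightarrow> prime (p x)"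
    using p Q(3) by (auto simp: bij_betw_def)
  define N where "N m = (\<Prod>x\<in>K. p x ^ Poly_Mapping.lookup m x)" for m :: "cvar \<Rightarrow>\<^sub>0 nat"
  have "inj_on N A"
  proof (rule inj_onI, rule poly_mapping_eqI)
    fix m m' x assume "m \<in> A" "m' \<in> A" "N m = N m'"
    then have "Poly_Mapping.lookup m x = Poly_Mapping.lookup m' x" if "x \<in> K"
      using prime_power_products_inj[OF \<open>finite K\<close> p_inj p_prime] that unfolding N_def by blast
    moreover have "Poly_Mapping.lookup m x = 0" "Poly_Mapping.lookup m' x = 0" if "x \<notin> K"
      using that \<open>m \<in> A\<close> \<open>m' \<in> A\<close> by (auto simp: K_def in_keys_iff)
    ultimately show "Poly_Mapping.lookup m x = Poly_Mapping.lookup m' x"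
      by metis
  qed
  let ?c = "\<lambda>m. Poly_Mapping.lookup F m - Poly_Mapping.lookup G m"
  have "(\<Sum>m\<in>A. ?c m * of_nat (N m) ^ j) = 0" for j
  proof -
    (* The value 0 off K keeps \<kappa> finitely supported; F and G do not contain these variables. *)
    define \<kappa> where "\<kappa> x = (if x \<in> K then p x ^ j else 0)" for x
    have "monom_eval m (\<lambda>x. of_nat (\<kappa> x)) = (of_nat (N m) ^ j :: 'k)" if "m \<in> A" for m
    proof -
      have "monom_eval m (\<lambda>x. of_nat (\<kappa> x)) =
          (\<Prod>x\<in>K. (of_nat (\<kappa> x) :: 'k) ^ Poly_Mapping.lookup m x)"
        using that \<open>finite K\<close> by (intro monom_eval_superset) (auto simp: K_def)
      also have "\<dots> = of_nat (N m) ^ j"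
        by (simp add: N_def \<kappa>_def prod_power_distrib mult.commute flip: power_mult)
      finally show ?thesis .
    qed
    then have ev: "eval_cpoly H (\<lambda>x. of_nat (\<kappa> x)) = (\<Sum>m\<in>A. Poly_Mapping.lookup H m * of_nat (N m) ^ j)"
      if "Poly_Mapping.keys H \<subseteq> A" for H :: "'k cpoly"
      using that \<open>finite A\<close> by (simp add: eval_cpoly_superset[of A])
    have "eval_cpoly F (\<lambda>x. of_nat (\<kappa> x)) = eval_cpoly G (\<lambda>x. of_nat (\<kappa> x))"
    proof (rule eq)
      show "finite {x. \<kappa> x \<noteq> 0}"
        by (rule finite_subset[OF _ \<open>finite K\<close>]) (auto simp: \<kappa>_def)
      show "1 \<le> cvar_index x" if "\<kappa> x \<noteq> 0" for x
        using that K_index by (auto simp: \<kappa>_def split: if_splits)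
    qed
    then show ?thesis
      by (subst (asm) (1 2) ev) (auto simp: A_def left_diff_distrib sum_subtractf)
  qed
  moreover have "inj_on (\<lambda>m. of_nat (N m) :: 'k) A"
    using \<open>inj_on N A\<close> by (auto simp: inj_on_def)
  ultimately have "?c m = 0" if "m \<in> A" for m
    using power_sums_eq_0_imp_coeffs_eq_0[of A "\<lambda>m. of_nat (N m)" ?c] that \<open>finite A\<close> by blast
  moreover have "?c m = 0" if "m \<notin> A" for m
    using that by (simp add: A_def in_keys_iff)
  ultimately show ?thesis
    by (intro poly_mapping_eqI) (metis eq_iff_diff_eq_0)
qed

section \<open>Signed permutations with given cycle counts\<close>

lemma signed_permsI:
  assumes "w \<in> extensional (signed n)"
    and "\<And>x. x \<in> signed n \<Longrightarrow> w x \<in> signed n"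
    and "\<And>x. x \<in> signed n \<Longrightarrow> w (- x) = - w x"
    and "\<And>x y. x \<in> signed n \<Longrightarrow> y \<in> signed n \<Longrightarrow> w x = w y \<Longrightarrow> x = y"
  shows "w \<in> signed_perms n"
proof -
  have "inj_on w (signed n)"
    using assms(4) by (rule inj_onI)
  moreover have "w ` signed n \<subseteq> signed n"
    using assms(2) by auto
  ultimately show ?thesis
    using assms(1,3) by (simp add: signed_perms_def bij_betw_def endo_inj_surj)
qed

text \<open>Appending the block \<open>n + 1, \<dots>, n + r\<close> as a single cycle; the sign of this cycle is that of the
  one arrow that closes it up.\<close>

definition add_cycle :: "nat \<Rightarrow> (int \<Rightarrow> int) \<Rightarrow> nat \<Rightarrow> int \<Rightarrow> int \<Rightarrow> int" where
  "add_cycle n w r \<epsilon> = (\<lambda>y\<in>signed (n + r). if \<bar>y\<bar> \<le> int n then w y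
     else sgn y * (if \<bar>y\<bar> < int (n + r) then \<bar>y\<bar> + 1 else \<epsilon> * (int n + 1)))"

lemma add_cycle_in_signed_perms:
  assumes w: "w \<in> signed_perms n" and \<epsilon>: "\<epsilon> \<in> {1, - 1}"
  shows "add_cycle n w r \<epsilon> \<in> signed_perms (n + r)"
proof (rule signed_permsI)
  let ?v = "add_cycle n w r \<epsilon>"
  have old: "?v x = w x" "x \<in> signed n" "\<bar>?v x\<bar> \<le> int n" "?v x \<noteq> 0" "w (- x) = - w x"
    if "x \<in> signed (n + r)" "\<bar>x\<bar> \<le> int n" for x
  proof -
    show x: "x \<in> signed n" and "?v x = w x"
      using that by (auto simp: signed_iff_abs add_cycle_def)
    then show "\<bar>?v x\<bar> \<le> int n" "?v x \<noteq> 0" "w (- x) = - w x"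
      using signed_permsD(1,2)[OF w x] by (auto simp: signed_iff_abs)
  qed
  have new: "?v x = sgn x * (if \<bar>x\<bar> < int (n + r) then \<bar>x\<bar> + 1 else \<epsilon> * (int n + 1))"
    "\<bar>?v x\<bar> = (if \<bar>x\<bar> < int (n + r) then \<bar>x\<bar> + 1 else int n + 1)"
    "\<bar>?v x\<bar> > int n" "\<bar>?v x\<bar> \<le> int (n + r)"
    if "x \<in> signed (n + r)" "\<not> \<bar>x\<bar> \<le> int n" for x
    using that \<epsilon> by (auto simp: signed_iff_abs add_cycle_def abs_mult sgn_if)
  show "?v \<in> extensional (signed (n + r))"
    by (simp add: add_cycle_def)
  show "?v x \<in> signed (n + r)" if "x \<in> signed (n + r)" for x
    using old[OF that] new[OF that] by (cases "\<bar>x\<bar> \<le> int n") (auto simp: signed_iff_abs)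
  show odd: "?v (- x) = - ?v x" if "x \<in> signed (n + r)" for x
    using that old[OF that] old[of "- x"] new(1)[OF that] new(1)[of "- x"]
    by (cases "\<bar>x\<bar> \<le> int n") (auto simp: sgn_minus)
  show "x = y" if x: "x \<in> signed (n + r)" and y: "y \<in> signed (n + r)" and eq: "?v x = ?v y" for x y
  proof (cases "\<bar>x\<bar> \<le> int n")
    case True
    then have "\<bar>y\<bar> \<le> int n"
      using old(3)[OF x] new(3)[OF y] eq by force
    then show ?thesis
      using old(1,2)[OF x True] old(1,2)[OF y] eq signed_permsD(3)[OF w] by auto
  next
    case False
    then have y': "\<not> \<bar>y\<bar> \<le> int n"
      using old(3)[OF y] new(3)[OF x] eq by force
    have "\<bar>x\<bar> = \<bar>y\<bar>"
      using new(2)[OF x False] new(2)[OF y y'] eq False y' x y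
      by (auto simp: signed_iff_abs split: if_splits)
    moreover have "?v y \<noteq> 0"
      using new(3)[OF y y'] by auto
    ultimately show ?thesis
      using odd[OF y] eq by (auto simp: abs_eq_iff)
  qed
qed

lemma cycles_add_cycle:
  assumes w: "w \<in> signed_perms n" and \<epsilon>: "\<epsilon> \<in> {1, - 1}" and r: "r \<ge> 1"
  shows "cycles (n + r) (add_cycle n w r \<epsilon>) = insert {int n + 1..int (n + r)} (cycles n w)"
proof -
  let ?v = "add_cycle n w r \<epsilon>" and ?B = "{int n + 1..int (n + r)}"
  have v: "?v \<in> signed_perms (n + r)"
    by (rule add_cycle_in_signed_perms[OF w \<epsilon>])
  have old: "orbit (abs_perm ?v) i = orbit (abs_perm w) i" if "i \<in> {1..int n}" for i
  proof (rule orbit_cong0[OF that])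
    have eq: "abs_perm ?v y = abs_perm w y" if "y \<in> {1..int n}" for y
      using that by (auto simp: add_cycle_def signed_iff_abs)
    then show "abs_perm ?v y = abs_perm w y" if "y \<in> {1..int n}" for y
      using that .
    show "abs_perm ?v \<in> {1..int n} \<rightarrow> {1..int n}"
      using eq bij_betwE[OF abs_perm_bij[OF w]] by (intro funcsetI) auto
  qed
  have iter: "(abs_perm ?v ^^ m) (int n + 1) = int n + 1 + int m" if "m < r" for m
    using that by (induction m) (auto simp: add_cycle_def signed_iff_abs sgn_if)
  have "abs_perm ?v (int (n + r)) = int n + 1"
    using r \<epsilon> by (auto simp: add_cycle_def signed_iff_abs sgn_if abs_mult)
  moreover have "(abs_perm ?v ^^ (r - 1)) (int n + 1) = int (n + r)"
    using iter[of "r - 1"] r by auto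
  ultimately have "(abs_perm ?v ^^ Suc (r - 1)) (int n + 1) = int n + 1"
    by simp
  then have "orbit (abs_perm ?v) (int n + 1) = {(abs_perm ?v ^^ m) (int n + 1) | m. m < r}"
    using r by (intro orbit_altdef_bounded) auto
  also have "\<dots> = (\<lambda>m. (abs_perm ?v ^^ m) (int n + 1)) ` {..<r}"
    by auto
  also have "\<dots> = (\<lambda>m. int n + 1 + int m) ` {..<r}"
    using iter by (intro image_cong) auto
  also have "\<dots> = ?B"
  proof (intro equalityI subsetI)
    fix y assume "y \<in> ?B"
    then have "y = int n + 1 + int (nat (y - int n - 1))" "nat (y - int n - 1) < r"
      by auto
    then show "y \<in> (\<lambda>m. int n + 1 + int m) ` {..<r}"
      by blast
  qed auto
  finally have B: "orbit (abs_perm ?v) (int n + 1) = ?B" .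
  then have B_cycle: "?B \<in> cycles (n + r) ?v"
    using orbit_cycles(1)[OF v, of "int n + 1"] r by simp
  have new: "orbit (abs_perm ?v) i = ?B" if "i \<in> ?B" for i
    by (rule orbit_cycles(4)[OF v B_cycle that])
  have "{1..int (n + r)} = {1..int n} \<union> ?B"
    by auto
  then have "cycles (n + r) ?v =
      orbit (abs_perm ?v) ` {1..int n} \<union> orbit (abs_perm ?v) ` ?B"
    by (simp only: cycles_def image_Un)
  moreover have "orbit (abs_perm ?v) ` {1..int n} = cycles n w"
    unfolding cycles_def using old by (intro image_cong) auto
  moreover have "orbit (abs_perm ?v) ` ?B = (\<lambda>_. ?B) ` ?B"
    using new by (intro image_cong) auto
  moreover have "(\<lambda>_. ?B) ` ?B = {?B}"
    using r by (intro image_constant[of "int n + 1"]) simp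
  ultimately show ?thesis
    by simp
qed

lemma cycle_count_add_cycle:
  assumes w: "w \<in> signed_perms n" and x: "cvar_index x \<ge> 1"
    and \<epsilon>: "\<epsilon> = (case x of XVar _ \<Rightarrow> 1 | YVar _ \<Rightarrow> - 1)"
  shows "cycle_count (n + cvar_index x) (add_cycle n w (cvar_index x) \<epsilon>) y =
    cycle_count n w y + (if y = x then 1 else 0)"
proof -
  let ?r = "cvar_index x"
  let ?v = "add_cycle n w ?r \<epsilon>" and ?B = "{int n + 1..int (n + ?r)}"
  have \<epsilon>': "\<epsilon> \<in> {1, - 1}"
    by (auto simp: \<epsilon> split: cvar.split)
  have v: "?v i = w i" if "i \<in> {1..int n}" for i
    using that by (auto simp: add_cycle_def signed_iff_abs)
  have vB: "?v i = (if i < int (n + ?r) then i + 1 else \<epsilon> * (int n + 1))" if "i \<in> ?B" for i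
    using that by (auto simp: add_cycle_def signed_iff_abs sgn_if)
  have old: "cycle_type ?v C = cycle_type w C" if "C \<in> cycles n w" for C
  proof -
    have "C \<subseteq> {1..int n}"
      using orbit_cycles(3)[OF w that] .
    then have "{i \<in> C. ?v i < 0} = {i \<in> C. w i < 0}"
      using v by auto
    then show ?thesis
      by (simp add: cycle_type_def sign_reversals_def)
  qed
  have new: "cycle_type ?v ?B = x"
  proof (cases x)
    case (XVar r)
    then have "{i \<in> ?B. ?v i < 0} = {}"
      using vB by (auto simp: \<epsilon>)
    then have "sign_reversals ?v ?B = 0"
      by (simp only: sign_reversals_def card.empty)
    then show ?thesis
      using XVar by (simp add: cycle_type_def)
  next
    case (YVar r)
    then have "{i \<in> ?B. ?v i < 0} = {int (n + ?r)}"
      using vB x by (auto simp: \<epsilon> split: if_splits)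
    then have "sign_reversals ?v ?B = card {int (n + ?r)}"
      by (simp only: sign_reversals_def)
    then show ?thesis
      using YVar by (simp add: cycle_type_def)
  qed
  have "int n + 1 \<in> ?B"
    using x by simp
  then have nin: "?B \<notin> cycles n w"
    using orbit_cycles(3)[OF w, of ?B] by force
  have "{C \<in> cycles (n + ?r) ?v. cycle_type ?v C = y} =
      (if y = x then {?B} else {}) \<union> {C \<in> cycles n w. cycle_type w C = y}"
    unfolding cycles_add_cycle[OF w \<epsilon>' x] using old new by auto
  also have "card \<dots> = (if y = x then 1 else 0) + card {C \<in> cycles n w. cycle_type w C = y}"
    using nin by (subst card_Un_disjoint) auto
  finally show ?thesis
    by (simp add: cycle_count_eq_type_count type_count_def)
qed

lemma restrict_id_in_signed_perms: "restrict id (signed n) \<in> signed_perms n"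
  by (rule signed_permsI) auto

lemma exists_signed_perm_with_counts_multiset:
  assumes "\<forall>x\<in>#M. 1 \<le> cvar_index x"
  shows "\<exists>n. \<exists>w\<in>signed_perms n. \<forall>x. cycle_count n w x = count M x"
  using assms
proof (induction M)
  case empty
  have "cycle_count 0 w x = 0" for w x
    by (simp add: cycle_count_eq_type_count type_count_def cycles_def)
  then show ?case
    using restrict_id_in_signed_perms[of 0] by auto
next
  case (add x M)
  then obtain n w where w: "w \<in> signed_perms n" "\<And>y. cycle_count n w y = count M y"
    by auto
  let ?\<epsilon> = "case x of XVar _ \<Rightarrow> 1 | YVar _ \<Rightarrow> - 1"
  have "?\<epsilon> \<in> {1, - 1}"
    by (auto split: cvar.split)
  then have "add_cycle n w (cvar_index x) ?\<epsilon> \<in> signed_perms (n + cvar_index x)"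
    by (rule add_cycle_in_signed_perms[OF w(1)])
  moreover have "cycle_count (n + cvar_index x) (add_cycle n w (cvar_index x) ?\<epsilon>) y =
      count (add_mset x M) y" for y
    using cycle_count_add_cycle[OF w(1) _ refl, of x y] add.prems w(2) by simp
  ultimately show ?case
    by blast
qed

lemma exists_signed_perm_with_counts:
  fixes \<kappa> :: "cvar \<Rightarrow> nat"
  assumes "finite {x. \<kappa> x \<noteq> 0}" "\<And>x. \<kappa> x \<noteq> 0 \<Longrightarrow> 1 \<le> cvar_index x"
  shows "\<exists>n. \<exists>w\<in>signed_perms n. \<forall>x. cycle_count n w x = \<kappa> x"
proof -
  have c: "count (Abs_multiset \<kappa>) = \<kappa>"
    using assms(1) by simp
  have "\<forall>x\<in>#Abs_multiset \<kappa>. 1 \<le> cvar_index x"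
    using assms(2) c by (metis count_eq_zero_iff)
  then show ?thesis
    using exists_signed_perm_with_counts_multiset[of "Abs_multiset \<kappa>"] c by simp
qed

lemma character_polynomial_unique:
  fixes F G :: "'k::field_char_0 cpoly"
  assumes "F \<in> character_polys" "G \<in> character_polys"
    and "\<And>n w. w \<in> signed_perms n \<Longrightarrow> cpoly_fun F n w = cpoly_fun G n w"
  shows "F = G"
proof (rule cpoly_eqI[OF assms(1,2)])
  fix \<kappa> :: "cvar \<Rightarrow> nat"
  assume "finite {x. \<kappa> x \<noteq> 0}" "\<And>x. \<kappa> x \<noteq> 0 \<Longrightarrow> 1 \<le> cvar_index x"
  then obtain n w where "w \<in> signed_perms n" "\<And>x. cycle_count n w x = \<kappa> x"
    using exists_signed_perm_with_counts by metis
  then show "eval_cpoly F (\<lambda>x. of_nat (\<kappa> x)) = eval_cpoly G (\<lambda>x. of_nat (\<kappa> x))"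
    using assms(3)[of w n] by (simp add: cpoly_fun_def)
qed

section \<open>Specialization at the identity\<close>

lemma cycle_count_identity:
  "cycle_count n (restrict id (signed n)) = (\<lambda>_. 0)(XVar 1 := n)"
proof
  fix x
  let ?w = "restrict id (signed n)"
  have "orbit (abs_perm ?w) i = {i}" if "i \<in> {1..int n}" for i
    unfolding orbit_eq_singleton_iff using that by (auto simp: signed_iff_abs)
  then have cyc: "cycles n ?w = (\<lambda>i. {i}) ` {1..int n}"
    unfolding cycles_def by (intro image_cong) auto
  have "cycle_type ?w {i} = XVar 1" if "i \<in> {1..int n}" for i
  proof -
    have "{j \<in> {i}. ?w j < 0} = {}"
      using that by (auto simp: signed_iff_abs)
    then have "sign_reversals ?w {i} = 0"
      by (simp only: sign_reversals_def card.empty)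
    then show ?thesis
      by (simp add: cycle_type_def)
  qed
  then have "{C \<in> cycles n ?w. cycle_type ?w C = x} = (if x = XVar 1 then (\<lambda>i. {i}) ` {1..int n} else {})"
    unfolding cyc by auto
  then show "cycle_count n ?w x = ((\<lambda>_. 0)(XVar 1 := n)) x"
    by (simp add: cycle_count_eq_type_count type_count_def card_image)
qed

text \<open>Substituting polynomials for the variables, \<open>X\<^sub>1\<close> by the identity polynomial and all others by
  0, gives the polynomial in one variable; \<open>X\<^sub>1\<close> has weight 1, so degrees do not grow.\<close>

lemma eval_X1_poly:
  fixes F :: "'k::field cpoly"
  assumes "cpoly_deg F \<le> d"
  shows "\<exists>p :: 'k poly. degree p \<le> d \<and> (\<forall>t. poly p t = eval_X1 F t)"
proof -
  let ?\<phi> = "(\<lambda>_. 0)(XVar 1 := [:0, 1 :: 'k:])"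
  let ?q = "\<lambda>m. \<Prod>x\<in>Poly_Mapping.keys m. ?\<phi> x ^ Poly_Mapping.lookup m x"
  define p where "p = (\<Sum>m\<in>Poly_Mapping.keys F. smult (Poly_Mapping.lookup F m) (?q m))"
  have "degree (?q m) \<le> monom_deg m" for m
  proof -
    have "degree (?\<phi> x ^ Poly_Mapping.lookup m x) \<le> Poly_Mapping.lookup m x * cvar_index x" for x
      using degree_power_le[of "?\<phi> x" "Poly_Mapping.lookup m x"] by (cases "x = XVar 1") auto
    then have "(\<Sum>x\<in>Poly_Mapping.keys m. degree (?\<phi> x ^ Poly_Mapping.lookup m x)) \<le> monom_deg m"
      unfolding monom_deg_def by (rule sum_mono)
    with degree_prod_sum_le[of "Poly_Mapping.keys m" "\<lambda>x. ?\<phi> x ^ Poly_Mapping.lookup m x"]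
    show ?thesis
      by (simp add: o_def)
  qed
  then have "degree p \<le> d"
    unfolding p_def using assms
    by (intro degree_sum_le) (auto simp: cpoly_deg_le_iff intro: order_trans degree_smult_le)
  moreover have "poly p t = eval_X1 F t" for t
    by (auto simp: p_def eval_X1_def eval_cpoly_def poly_sum poly_prod intro!: sum.cong prod.cong)
  ultimately show ?thesis
    by blast
qed

section \<open>Trace functions of bounded degree are character polynomials\<close>

lemma sum_card_eq_sum_type_count:
  assumes "finite D" "finite X" "cycle_type w ` D \<subseteq> X"
  shows "(\<Sum>C\<in>D. card C) = (\<Sum>x\<in>X. type_count w D x * cvar_index x)"
proof -
  have "(\<Sum>C\<in>D. card C) = (\<Sum>x\<in>X. \<Sum>C\<in>{C \<in> D. cycle_type w C = x}. card C)"
    using assms by (rule sum.group[symmetric])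
  also have "\<dots> = (\<Sum>x\<in>X. type_count w D x * cvar_index x)"
  proof (intro sum.cong refl)
    fix x
    have "card C = cvar_index x" if "cycle_type w C = x" for C
      using cvar_index_cycle_type[of w C] that by simp
    then show "(\<Sum>C\<in>{C \<in> D. cycle_type w C = x}. card C) = type_count w D x * cvar_index x"
      by (simp add: type_count_def)
  qed
  finally show ?thesis .
qed

text \<open>The summand for a set \<open>D\<close> of cycles depends only on the type of \<open>D\<close>. Collecting the sets of
  the same type leaves a finite sum over types, in which the products of binomial coefficients
  depend on the permutation through its cycle counts only.\<close>

lemma trace_function_eq_character_polynomial:
  fixes \<theta> :: "nat \<Rightarrow> (int \<Rightarrow> int) \<Rightarrow> 'k::field_char_0"
  assumes "trace_function \<theta>"
    and vanish: "\<And>n w S. w \<in> signed_perms n \<Longrightarrow> S \<subseteq> {1..int n} \<Longrightarrow> d < card S \<Longrightarrow>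
      trace_function.local_trace \<theta> n w S = 0"
  shows "\<exists>F\<in>character_polys. cpoly_deg F \<le> d \<and>
    (\<forall>n. \<forall>w\<in>signed_perms n. \<theta> n (extend0 n w) = cpoly_fun F n w)"
proof -
  interpret trace_function \<theta> by fact
  define t where "t n w D = (-1) ^ card (\<Union>D) * local_trace n w (\<Union>D)" for n w and D :: "int set set"
  (* a \<tau> is the common value of t on all sets of cycles of type \<tau>; the choice of a
     representative is arbitrary when \<tau> is the type of no set. *)
  define Q where "Q \<tau> p \<longleftrightarrow> (case p of (n, w, D) \<Rightarrow>
    w \<in> signed_perms n \<and> D \<subseteq> cycles n w \<and> type_count w D = \<tau>)" for \<tau> p
  define a where "a \<tau> = (case SOME p. Q \<tau> p of (n, w, D) \<Rightarrow> t n w D)" for \<tau>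
  (* The types of cycles of length at most d, and the types of sets of cycles of total size at
     most d. The bound \<tau> x \<le> d follows from the bound on the total size and makes \<T> visibly
     finite. *)
  define X where "X = XVar ` {1..d} \<union> YVar ` {1..d}"
  have X: "finite X" "\<And>x. x \<in> X \<longleftrightarrow> 1 \<le> cvar_index x \<and> cvar_index x \<le> d"
  proof -
    show "finite X" by (simp add: X_def)
    show "x \<in> X \<longleftrightarrow> 1 \<le> cvar_index x \<and> cvar_index x \<le> d" for x
      by (cases x) (auto simp: X_def)
  qed
  define \<T> where "\<T> = {\<tau>. (\<forall>x. (x \<in> X \<longrightarrow> \<tau> x \<in> {..d}) \<and> (x \<notin> X \<longrightarrow> \<tau> x = 0)) \<and>
    (\<Sum>x\<in>X. \<tau> x * cvar_index x) \<le> d}"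
  have fin: "finite \<T>"
    by (rule finite_subset[OF _ finite_set_of_finite_funs[of X "{..d}" 0]]) (auto simp: \<T>_def X(1))
  have t_eq: "t n w D = a (type_count w D)" if "w \<in> signed_perms n" "D \<subseteq> cycles n w" for n w D
  proof -
    obtain n' w' D' where s: "(SOME p. Q (type_count w D) p) = (n', w', D')"
      by (metis prod_cases3)
    have "Q (type_count w D) (n, w, D)"
      using that by (simp add: Q_def)
    then have "Q (type_count w D) (n', w', D')"
      unfolding s[symmetric] by (rule someI)
    then have w': "w' \<in> signed_perms n'" "D' \<subseteq> cycles n' w'"
      and types: "\<And>x. type_count w D x = type_count w' D' x"
      by (auto simp: Q_def)
    have fins: "finite D" "finite D'"
      using that(2) w'(2) by (auto intro: finite_subset[OF _ finite_cycles])
    have "(\<Sum>C\<in>D. card C) = (\<Sum>C\<in>D'. card C)"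
      using sum_card_eq_sum_type_count[of D "cycle_type w ` D \<union> cycle_type w' ` D'" w]
        sum_card_eq_sum_type_count[of D' "cycle_type w ` D \<union> cycle_type w' ` D'" w'] fins types
      by simp
    then have "card (\<Union>D) = card (\<Union>D')"
      using card_Union_cycles that w' by metis
    then show ?thesis
      using local_trace_eqI[OF that w' types] by (simp add: a_def s t_def)
  qed
  have support: "type_count w D \<in> \<T>"
    if w: "w \<in> signed_perms n" and D: "D \<subseteq> cycles n w" and nz: "t n w D \<noteq> 0" for n w D
  proof -
    have "\<Union>D \<subseteq> {1..int n}"
      using orbit_cycles(3)[OF w] D by blast
    then have le: "(\<Sum>C\<in>D. card C) \<le> d"
      using vanish[OF w, of "\<Union>D"] nz card_Union_cycles[OF w D] by (force simp: t_def)
    have fD: "finite D"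
      using D by (auto intro: finite_subset[OF _ finite_cycles])
    have "card C \<le> d" if "C \<in> D" for C
      using member_le_sum[OF that, of card] fD le by simp
    then have sub: "cycle_type w ` D \<subseteq> X"
      using cycles_finite_card(3)[OF w] D by (force simp: X(2))
    have sum: "(\<Sum>x\<in>X. type_count w D x * cvar_index x) \<le> d"
      using sum_card_eq_sum_type_count[OF fD X(1) sub] le by simp
    have "type_count w D x \<le> d" if "x \<in> X" for x
    proof -
      have "type_count w D x \<le> type_count w D x * cvar_index x"
        using that by (simp add: X(2))
      also have "\<dots> \<le> (\<Sum>x\<in>X. type_count w D x * cvar_index x)"
        using that X(1) by (intro member_le_sum) auto
      finally show ?thesis
        using sum by simp
    qed
    moreover have "type_count w D x = 0" if "x \<notin> X" for x
    proof -
      have "{C \<in> D. cycle_type w C = x} = {}"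
        using sub that by auto
      then show ?thesis
        by (simp only: type_count_def card.empty)
    qed
    ultimately show ?thesis
      using sum by (simp add: \<T>_def)
  qed
  have formula: "\<theta> n (extend0 n w) =
      (\<Sum>\<tau>\<in>\<T>. a \<tau> * (\<Prod>x\<in>X. of_nat (cycle_count n w x) gchoose \<tau> x))"
    if w: "w \<in> signed_perms n" for n w
  proof -
    let ?P = "{D \<in> Pow (cycles n w). type_count w D \<in> \<T>}"
    have "\<theta> n (extend0 n w) = (\<Sum>D\<in>Pow (cycles n w). t n w D)"
      using trace_eq_sum_cycles[OF w] by (simp add: t_def)
    also have "\<dots> = (\<Sum>D\<in>?P. t n w D)"
      using support[OF w] by (intro sum.mono_neutral_right) auto
    also have "\<dots> = (\<Sum>D\<in>?P. a (type_count w D))"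
      using t_eq[OF w] by (intro sum.cong) auto
    also have "\<dots> = (\<Sum>\<tau>\<in>\<T>. \<Sum>D\<in>{D \<in> ?P. type_count w D = \<tau>}. a (type_count w D))"
      using fin by (intro sum.group[symmetric]) auto
    also have "\<dots> = (\<Sum>\<tau>\<in>\<T>. a \<tau> * (\<Prod>x\<in>X. of_nat (cycle_count n w x) gchoose \<tau> x))"
    proof (intro sum.cong refl)
      fix \<tau> assume \<tau>: "\<tau> \<in> \<T>"
      have "{D \<in> ?P. type_count w D = \<tau>} = {D. D \<subseteq> cycles n w \<and> cycle_type w ` D \<subseteq> X \<and>
          (\<forall>x\<in>X. card {C \<in> D. cycle_type w C = x} = \<tau> x)}" (is "?A = ?B")
      proof (intro equalityI subsetI)
        fix D assume D: "D \<in> ?A"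
        then have fD: "finite D"
          by (auto intro: finite_subset[OF _ finite_cycles])
        have "cycle_type w C \<in> X" if "C \<in> D" for C
        proof (rule ccontr)
          assume "cycle_type w C \<notin> X"
          then have "card {C' \<in> D. cycle_type w C' = cycle_type w C} = 0"
            using D \<tau> by (auto simp: \<T>_def type_count_def)
          then show False
            using fD that by auto
        qed
        then show "D \<in> ?B"
          using D by (auto simp: type_count_def)
      next
        fix D assume D: "D \<in> ?B"
        have "type_count w D x = \<tau> x" for x
        proof (cases "x \<in> X")
          case True
          then show ?thesis
            using D by (simp add: type_count_def)
        next
          case False
          then have "{C \<in> D. cycle_type w C = x} = {}"
            using D by auto
          then have "type_count w D x = 0"
            by (simp only: type_count_def card.empty)
          then show ?thesis
            using False \<tau> by (simp add: \<T>_def)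
        qed
        then have "type_count w D = \<tau>"
          by (rule ext)
        then show "D \<in> ?A"
          using D \<tau> by auto
      qed
      then have "card {D \<in> ?P. type_count w D = \<tau>} = (\<Prod>x\<in>X. cycle_count n w x choose \<tau> x)"
        using card_subsets_with_fibre_cards[OF finite_cycles X(1), of n w "cycle_type w" \<tau>]
        by (simp add: cycle_count_eq_type_count type_count_def)
      moreover have "(\<Sum>D\<in>{D \<in> ?P. type_count w D = \<tau>}. a (type_count w D)) =
          of_nat (card {D \<in> ?P. type_count w D = \<tau>}) * a \<tau>"
        by (subst sum.cong[OF refl, where h = "\<lambda>_. a \<tau>"]) auto
      ultimately show "(\<Sum>D\<in>{D \<in> ?P. type_count w D = \<tau>}. a (type_count w D)) =
          a \<tau> * (\<Prod>x\<in>X. of_nat (cycle_count n w x) gchoose \<tau> x)"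
        by (simp only: of_nat_prod binomial_gbinomial mult.commute)
    qed
    finally show ?thesis .
  qed
  have "cpoly_representable d (\<lambda>\<phi>. \<Sum>\<tau>\<in>\<T>. a \<tau> * (\<Prod>x\<in>X. \<phi> x gchoose \<tau> x))"
  proof (intro cpoly_representable_sum cpoly_representable_cmult)
    fix \<tau> assume "\<tau> \<in> \<T>"
    then have "(\<Sum>x\<in>X. \<tau> x * cvar_index x) \<le> d"
      by (simp add: \<T>_def)
    then show "cpoly_representable d (\<lambda>\<phi> :: cvar \<Rightarrow> 'k. \<Prod>x\<in>X. \<phi> x gchoose \<tau> x)"
      using X by (intro cpoly_representable_mono[OF cpoly_representable_prod_gbinomial]) simp_all
  qed
  then show ?thesis
    using formula unfolding cpoly_representable_def cpoly_fun_def by metis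
qed

section \<open>Finitely generated modules\<close>

text \<open>The spans of the images of the generators form a submodule, hence are everything.\<close>

lemma (in kmod_functor) finitely_generated_le_imp_span:
  assumes fg: "finitely_generated_le d"
    and comp: "\<And>l m n f g. f \<in> Hom l m \<Longrightarrow> g \<in> Hom m n \<Longrightarrow> compose (Obj l) g f \<in> Hom l n"
    and id: "\<And>n. restrict id (Obj n) \<in> Hom n n"
    and fin: "\<And>m n. finite (Hom m n)"
  shows "finite_dim_on (V n)"
    "V n = span {act m n f v | m f v. m \<le> d \<and> f \<in> Hom m n \<and> v \<in> V m}"
proof -
  obtain S where S: "finite S" "S \<subseteq> (SIGMA n:{..d}. V n)"
    and gen: "\<And>W. submodule W \<Longrightarrow> S \<subseteq> (SIGMA n:UNIV. W n) \<Longrightarrow> W = V"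
    using fg by (auto simp: finitely_generated_le_def)
  define G where "G n = (\<Union>(m, v)\<in>S. (\<lambda>f. act m n f v) ` Hom m n)" for n
  have G_in: "G n \<subseteq> V n" for n
    using S(2) by (auto simp: G_def intro!: act_in)
  have sub: "span (G n) \<subseteq> V n" for n
    using G_in subspace_V by (rule span_minimal)
  have "submodule (\<lambda>n. span (G n))"
    unfolding submodule_def
  proof (intro conjI allI ballI)
    show "subspace (span (G n))" "span (G n) \<subseteq> V n" for n
      using sub by (simp_all add: subspace_span)
    fix m n f v assume f: "f \<in> Hom m n" and v: "v \<in> span (G m)"
    have "v \<in> {v \<in> V m. act m n f v \<in> span (G n)}"
    proof (rule span_subspace_induct[OF v])
      show "subspace {v \<in> V m. act m n f v \<in> span (G n)}"
      proof (rule subspaceI)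
        have "act m n f (scale 0 0) = scale 0 (act m n f 0)"
          using f subspace_0[OF subspace_V] by (rule act_scale)
        then show "0 \<in> {v \<in> V m. act m n f v \<in> span (G n)}"
          by (simp add: subspace_0[OF subspace_V] span_zero)
      qed (use f in \<open>auto simp: act_add act_scale subspace_add[OF subspace_V]
          subspace_scale[OF subspace_V] span_add span_scale\<close>)
      fix u assume "u \<in> G m"
      then obtain l g x where x: "(l, x) \<in> S" "g \<in> Hom l m" "u = act l m g x"
        by (auto simp: G_def)
      then have "x \<in> V l"
        using S(2) by auto
      then have "act m n f u = act l n (compose (Obj l) f g) x"
        using x f by (simp add: act_comp)
      then have "act m n f u \<in> G n"
        using x(1) comp[OF x(2) f] by (auto simp: G_def)
      then show "u \<in> {v \<in> V m. act m n f v \<in> span (G n)}"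
        using \<open>u \<in> G m\<close> G_in by (auto intro: span_base)
    qed
    then show "act m n f v \<in> span (G n)"
      by simp
  qed
  moreover have "S \<subseteq> (SIGMA n:UNIV. span (G n))"
  proof clarify
    fix m v assume mv: "(m, v) \<in> S"
    then have "v = act m m (restrict id (Obj m)) v"
      using S(2) by (subst act_id) auto
    then have "v \<in> G m"
      unfolding G_def using mv id[of m] by blast
    then show "m \<in> UNIV \<and> v \<in> span (G m)"
      by (auto intro: span_base)
  qed
  ultimately have V: "span (G n) = V n" for n
    using gen[of "\<lambda>n. span (G n)"] by metis
  have "finite (G n)" for n
    using S(1) fin by (auto simp: G_def)
  then show "finite_dim_on (V n)"
    using V unfolding finite_dim_on_def by blast
  let ?H = "{act m n f v | m f v. m \<le> d \<and> f \<in> Hom m n \<and> v \<in> V m}"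
  have "G n \<subseteq> ?H"
    using S(2) by (fastforce simp: G_def)
  then have "V n \<subseteq> span ?H"
    using V span_mono by blast
  moreover have "span ?H \<subseteq> V n"
    by (rule span_minimal[OF _ subspace_V]) (auto intro: act_in)
  ultimately show "V n = span ?H"
    by (rule antisym)
qed

lemma compose_in_FIBC:
  assumes "f \<in> FIBC l m" "g \<in> FIBC m n"
  shows "compose (signed l) g f \<in> FIBC l n"
proof -
  have f: "f a \<in> signed m" "f (- a) = - f a" if "a \<in> signed l" for a
    using assms(1) that by (auto simp: FIBC_def)
  have "inj_on (compose (signed l) g f) (signed l)"
    using assms f by (auto simp: FIBC_def inj_on_def compose_eq)
  then show ?thesis
    using assms(2) f by (auto simp: FIBC_def compose_eq compose_def PiE_def)
qed

lemma finite_FIBC: "finite (FIBC m n)"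
  by (rule finite_subset[of _ "signed m \<rightarrow>\<^sub>E signed n"]) (auto simp: FIBC_def intro: finite_PiE)

lemma restrict_id_in_FIBC: "restrict id (signed n) \<in> FIBC n n"
  by (auto simp: FIBC_def inj_on_def)

locale finitely_generated_sharp_module = kmod_functor scale signed0 FIBC_sharp V act
  for scale :: "'k::field_char_0 \<Rightarrow> 'v::ab_group_add \<Rightarrow> 'v" and V act +
  fixes d :: nat
  assumes generated: "kmod_functor.finitely_generated_le scale FIBC V (restrict_FIBC act) d"
begin

lemma finite_dim_on_V: "finite_dim_on (V n)"
  and V_eq_span: "V n = span {act m n (extend0 m f) v | m f v. m \<le> d \<and> f \<in> FIBC m n \<and> v \<in> V m}"
proof -
  have "FIBC_sharp_module scale V act" ..
  then interpret F: kmod_functor scale signed FIBC V "restrict_FIBC act"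
    by (rule FIBC_module_restrict)
  show "finite_dim_on (V n)"
    by (rule F.finitely_generated_le_imp_span(1)[OF generated compose_in_FIBC restrict_id_in_FIBC finite_FIBC])
  show "V n = span {act m n (extend0 m f) v | m f v. m \<le> d \<and> f \<in> FIBC m n \<and> v \<in> V m}"
    using F.finitely_generated_le_imp_span(2)[OF generated compose_in_FIBC restrict_id_in_FIBC finite_FIBC]
    unfolding restrict_FIBC_def .
qed

lemma trace_function_V: "trace_function (\<lambda>n f. trace_on (V n) (act n n f))"
  by unfold_locales (rule trace_act_cyclic[OF finite_dim_on_V])

text \<open>The projection \<open>\<pi>\<^sub>S\<close> vanishes on \<open>V\<^sub>n\<close>, expressed in coordinates so that the alternating sum
  has scalar terms. On the image of an injection \<open>f\<close> from an object \<open>m \<le> d\<close> the terms cancel in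
  pairs: some \<open>i \<in> S\<close> is not a value of \<open>|f|\<close>, so that \<open>e\<^sub>T f\<close> does not change when \<open>i\<close> is
  added to \<open>T\<close>.\<close>

lemma coordinate_alternating_sum_eq_0:
  assumes S: "S \<subseteq> {1..int n}" "d < card S" and u: "u \<in> V n"
  shows "(\<Sum>T\<in>Pow S. (-1) ^ card T *
    representation (basis_of (V n)) (act n n (partial_id n T) u) b) = 0"
proof -
  note B = basis_of_finite_dim[OF finite_dim_on_V[of n]]
  note p = partial_id_in_FIBC_sharp
  let ?r = "\<lambda>T u. representation (basis_of (V n)) (act n n (partial_id n T) u) b"
  let ?Z = "{u \<in> V n. (\<Sum>T\<in>Pow S. (-1) ^ card T * ?r T u) = 0}"
  have "finite S"
    using S(1) finite_subset by auto
  have in_span: "act n n (partial_id n T) v \<in> span (basis_of (V n))" if "v \<in> V n" for T v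
    using act_in[OF p that] B(2) by simp
  have "u \<in> ?Z"
  proof (rule span_subspace_induct[OF u[unfolded V_eq_span[of n]]])
    have r_add: "?r T (v + v') = ?r T v + ?r T v'" if "v \<in> V n" "v' \<in> V n" for T v v'
      using that by (simp add: act_add[OF p] representation_add[OF B(1)] in_span)
    have r_scale: "?r T (scale c v) = c * ?r T v" if "v \<in> V n" for T c v
      using that by (simp add: act_scale[OF p] representation_scale[OF B(1)] in_span)
    show "subspace ?Z"
    proof (rule subspaceI)
      have "?r T 0 = 0" for T
        using r_scale[OF subspace_0[OF subspace_V], of T 0] by simp
      then show "0 \<in> ?Z"
        by (simp add: subspace_0[OF subspace_V])
      show "x + y \<in> ?Z" if "x \<in> ?Z" "y \<in> ?Z" for x y
        using that by (simp add: r_add distrib_left sum.distrib subspace_add[OF subspace_V])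
      show "scale c x \<in> ?Z" if "x \<in> ?Z" for c x
        using that by (simp add: r_scale subspace_scale[OF subspace_V] mult.left_commute[of _ c]
            flip: sum_distrib_left)
    qed
    fix x assume "x \<in> {act m n (extend0 m f) v | m f v. m \<le> d \<and> f \<in> FIBC m n \<and> v \<in> V m}"
    then obtain m f v where x: "m \<le> d" "f \<in> FIBC m n" "v \<in> V m" "x = act m n (extend0 m f) v"
      by blast
    have f: "extend0 m f \<in> FIBC_sharp m n"
      by (rule extend0_in_FIBC_sharp[OF x(2)])
    have "card ((\<lambda>a. \<bar>f a\<bar>) ` {1..int m}) \<le> m"
      using card_image_le[of "{1..int m}" "\<lambda>a. \<bar>f a\<bar>"] by simp
    then have "\<not> S \<subseteq> (\<lambda>a. \<bar>f a\<bar>) ` {1..int m}"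
      using card_mono[of "(\<lambda>a. \<bar>f a\<bar>) ` {1..int m}" S] x(1) S(2) by auto
    then obtain i where i: "i \<in> S" "i \<notin> (\<lambda>a. \<bar>f a\<bar>) ` {1..int m}"
      by auto
    have not_i: "\<bar>f a\<bar> \<noteq> i" if "a \<in> signed m" for a
    proof -
      have "\<bar>f a\<bar> = \<bar>f \<bar>a\<bar>\<bar>"
        using x(2) that by (auto simp: FIBC_def abs_if)
      then show ?thesis
        using i(2) that by (auto simp: signed_iff_abs)
    qed
    have "compose (signed0 m) (partial_id n (insert i T)) (extend0 m f) =
        compose (signed0 m) (partial_id n T) (extend0 m f)" for T
    proof
      fix a
      show "compose (signed0 m) (partial_id n (insert i T)) (extend0 m f) a =
          compose (signed0 m) (partial_id n T) (extend0 m f) a"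
        using not_i[of a] by (auto simp: compose_def partial_id_def extend0_def signed_iff_signed0)
    qed
    then have "act n n (partial_id n (insert i T)) x = act n n (partial_id n T) x" for T
      unfolding x(4) using act_comp[OF f p x(3)] by metis
    then have "(\<Sum>T\<in>Pow S. (-1) ^ card T * ?r T x) = 0"
      by (intro alternating_sum_eq_0[OF \<open>finite S\<close> i(1)]) simp
    moreover have "x \<in> V n"
      unfolding x(4) by (rule act_in[OF f x(3)])
    ultimately show "x \<in> ?Z"
      by simp
  qed
  then show ?thesis
    by simp
qed

lemma local_trace_eq_0:
  assumes w: "w \<in> signed_perms n" and S: "S \<subseteq> {1..int n}" "d < card S"
  shows "trace_function.local_trace (\<lambda>n f. trace_on (V n) (act n n f)) n w S = 0"
proof -
  interpret trace_function "\<lambda>n f. trace_on (V n) (act n n f)"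
    by (rule trace_function_V)
  note B = basis_of_finite_dim[OF finite_dim_on_V[of n]]
  let ?w = "cut n w {1..int n}"
  have w': "?w \<in> FIBC_sharp n n"
    by (rule cut_in_FIBC_sharp[OF w])
  have cut: "act n n (cut n w T) v = act n n (partial_id n T) (act n n ?w v)"
    if "T \<subseteq> S" "v \<in> V n" for T v
  proof -
    have "T \<inter> {1..int n} = T"
      using that(1) S(1) by auto
    then have "cut n w T = compose (signed0 n) (partial_id n T) ?w"
      using compose_partial_id_cut[OF w, of T "{1..int n}"] by simp
    then show ?thesis
      using act_comp[OF w' partial_id_in_FIBC_sharp that(2)] by simp
  qed
  have "local_trace n w S = (\<Sum>T\<in>Pow S. \<Sum>b\<in>basis_of (V n). (-1) ^ card T *
      representation (basis_of (V n)) (act n n (partial_id n T) (act n n ?w b)) b)"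
    unfolding local_trace_def unfolding trace_on_basis_of sum_distrib_left
    using cut B(4) by (intro sum.cong refl) (auto simp: subset_iff)
  also have "\<dots> = (\<Sum>b\<in>basis_of (V n). \<Sum>T\<in>Pow S. (-1) ^ card T *
      representation (basis_of (V n)) (act n n (partial_id n T) (act n n ?w b)) b)"
    by (rule sum.swap)
  also have "\<dots> = 0"
    using coordinate_alternating_sum_eq_0[OF S] act_in[OF w'] B(4) by (intro sum.neutral) auto
  finally show ?thesis .
qed

lemma character_eq: "character scale V (restrict_FIBC act) n w = trace_on (V n) (act n n (extend0 n w))"
  by (simp add: character_def restrict_FIBC_def)

lemma character_identity:
  "character scale V (restrict_FIBC act) n (restrict id (signed n)) = of_nat (dim (V n))"
  unfolding character_eq extend0_id by (rule trace_on_id[OF finite_dim_on_V act_id])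

end

theorem corollary4p22:
  fixes scale :: "'k::field_char_0 \<Rightarrow> 'v::ab_group_add \<Rightarrow> 'v"
    and V :: "nat \<Rightarrow> 'v set"
    and act :: "nat \<Rightarrow> nat \<Rightarrow> (int \<Rightarrow> int) \<Rightarrow> 'v \<Rightarrow> 'v"
    and d :: nat
  assumes "FIBC_sharp_module scale V act"
    and "kmod_functor.finitely_generated_le scale FIBC V (restrict_FIBC act) d"
  shows "(\<forall>n. vector_space.finite_dim_on scale (V n)) \<and>
    (\<exists>F\<in>character_polys.
       (\<forall>n. \<forall>w\<in>signed_perms n. character scale V (restrict_FIBC act) n w = cpoly_fun F n w) \<and>
       (\<forall>G\<in>character_polys.
          (\<forall>n. \<forall>w\<in>signed_perms n. character scale V (restrict_FIBC act) n w = cpoly_fun G n w)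
          \<longrightarrow> G = F) \<and>
       cpoly_deg F \<le> d \<and>
       (\<exists>p :: 'k poly. degree p \<le> d \<and> (\<forall>t. poly p t = eval_X1 F t)) \<and>
       (\<forall>n. of_nat (vector_space.dim scale (V n)) = eval_X1 F (of_nat n)))"
proof -
  interpret finitely_generated_sharp_module scale V act d
    using assms by (simp add: finitely_generated_sharp_module_def finitely_generated_sharp_module_axioms_def)
  obtain F where F: "F \<in> character_polys" "cpoly_deg F \<le> d"
    "\<And>n w. w \<in> signed_perms n \<Longrightarrow> character scale V (restrict_FIBC act) n w = cpoly_fun F n w"
    using trace_function_eq_character_polynomial[OF trace_function_V local_trace_eq_0]
    unfolding character_eq by blast
  have "of_nat (dim (V n)) = eval_X1 F (of_nat n)" for n
  proof -
    have "of_nat (dim (V n)) = cpoly_fun F n (restrict id (signed n))"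
      using F(3)[OF restrict_id_in_signed_perms] character_identity by metis
    also have "\<dots> = eval_X1 F (of_nat n)"
      unfolding cpoly_fun_def eval_X1_def cycle_count_identity
      by (rule arg_cong[of _ _ "eval_cpoly F"]) auto
    finally show ?thesis .
  qed
  moreover have "G = F" if "G \<in> character_polys"
    "\<forall>n. \<forall>w\<in>signed_perms n. character scale V (restrict_FIBC act) n w = cpoly_fun G n w" for G
    using character_polynomial_unique[OF that(1) F(1)] that(2) F(3) by metis
  ultimately show ?thesis
    using finite_dim_on_V F eval_X1_poly[OF F(2)] by blast
qed

end
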